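(* Fix $d,\Omega,k,\Psi,\rho$ as below and $\varepsilon>0$, and let $\mathbf G_n^\varepsilon=\mathbf G^\varepsilon_{n,\mathrm{reg}}(d,\Omega,k,\Psi,\rho)$. Assume $$\lim_{n\to\infty}\frac1{n^2}\sum_{i,j=1}^n\mathbb E\left\|\mu_{\mathbf G^\varepsilon_n,x_i,x_j}-\mu_{\mathbf G^\varepsilon_n,x_i}\otimes\mu_{\mathbf G^\varepsilon_n,x_j}\right\|_{TV}=0 .$$ Then there is a sequence $(\delta_n)_n\to0$ such that with probability tending to $1$ as $n\to\infty$ the messages $(\mu_{\mathbf G^\varepsilon_n,x\to a},\mu_{\mathbf G^\varepsilon_n,a\to x})_{x\in V,a\in\partial x}$ form a $\delta_n$-Belief Propagation fixed point on $\mathbf G_n^\varepsilon$.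
   Context: Factor graphs: Fix a finite set $\Omega$ of spins. A factor graph $G$ consists of a finite set $V(G)$ of variable nodes, a finite set $F(G)$ of constraint nodes, for each $a\in F(G)$ an ordered tuple $\partial a=(y_1,\ldots,y_{d(a)})$ of variable nodes, and a weight function $\psi_a:\Omega^{d(a)}\to(0,\infty)$. For $x\in V(G)$ let $\partial x$ be the set of $a\in F(G)$ with $x$ appearing in $\partial a$; we also write $\partial a$ for the set of variable nodes appearing in the tuple. For $\tau\in\Omega^{\partial a}$ write $\psi_a(\tau)=\psi_a(\tau(y_1),\ldots,\tau(y_{d(a)}))$. The Gibbs measure is $\mu_G(\sigma)=Z_G^{-1}\prod_{a}\psi_a(\sigma(\partial a))$, $\sigma\in\Omega^{V(G)}$, with partition function $Z_G$. $\mu_{G,x}$, $\mu_{G,x,y}$ are the one- and two-point marginals. For $x\in\partial a$ the message $\mu_{G,x\to a}$ is the marginal of $x$ in the Gibbs measure of $G-a$, and $\mu_{G,a\to x}$ the marginal of $x$ in the Gibbs measure of $G$ with all $b\in\partial x\setminus\{a\}$ deleted. $\varepsilon$-BP fixed point: for $G$ with $n$ variable nodes, the messages form a $\delta$-Belief Propagation fixed point if $$\sum_{x}\sum_{a\in\partial x}\sum_{\sigma\in\Omega}\left|\mu_{G,x\to a}(\sigma)-\frac{\prod_{b\in\partial x\setminus a}\mu_{G,b\to x}(\sigma)}{\sum_{\tau}\prod_{b\in\partial x\setminus a}\mu_{G,b\to x}(\tau)}\right|+\left|\mu_{G,a\to x}(\sigma)-\frac{\sum_{\tau\in\Omega^{\partial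 a}}\mathbf 1\{\tau(x)=\sigma\}\psi_a(\tau)\prod_{y\in\partial a\setminus x}\mu_{G,y\to a}(\tau(y))}{\sum_{\tau\in\Omega^{\partial a}}\psi_a(\tau)\prod_{y\in\partial a\setminus x}\mu_{G,y\to a}(\tau(y))}\right|<\delta n.$$ Percolated regular model: $d$ a positive integer, $k\geq3$, $\Psi$ a finite nonempty set of functions $\Omega^k\to(0,\infty)$, $\rho$ a distribution on $\Psi$, all fixed as $n\to\infty$. For $\psi\in\Psi$ and $J\subset[k]$ let $\psi^J:\Omega^J\to(0,\infty)$, $\psi^J((\sigma_j)_{j\in J})=|\Omega|^{|J|-k}\sum_{(\sigma_j)_{j\notin J}}\psi(\sigma_1,\ldots,\sigma_k)$. $\mathbf G^\varepsilon_{n,\mathrm{reg}}(d,\Omega,k,\Psi,\rho)$ has variable nodes $x_1,\ldots,x_n$ and is generated by: (REG1) choose $m\sim\mathrm{Po}(dn/k)$; (REG2) independently for $i\in[m]$ obtain $J_i\subset[k]$ by including each element with probability $1-\varepsilon$ independently, choose $\psi_i\sim\rho$, and let constraint node $a_i$ have weight $\psi_{a_i}=\psi_i^{J_i}$ and $|J_i|$ ordered neighbour slots; (REG3) if $\sum_i|J_i|>dn$ start over, otherwise choose the neighbour tuples uniformly at random subject to every variable node having degree (number of slots it occupies) at most $d$. *)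

theory Defs
  imports "HOL-Probability.Probability"
begin

text \<open>Conventions. Spins: a finite type 'w.  Variable nodes x_1..x_n are 0..n-1.
A factor graph on n variables is a triple (m, nb, w): constraint nodes 0..m-1,
nb a = ordered neighbour tuple of a (list of variable nodes, entries < n),
w a = weight function of a, applied to the list of spins on the tuple nb a.\<close>

type_synonym 'w fgraph = "nat \<times> (nat \<Rightarrow> nat list) \<times> (nat \<Rightarrow> 'w list \<Rightarrow> real)"

definition configs :: "nat \<Rightarrow> (nat \<Rightarrow> 'w) set" where
  "configs n = PiE {..<n} (\<lambda>_. UNIV)"

definition gweight :: "(nat \<Rightarrow> nat list) \<Rightarrow> (nat \<Rightarrow> 'w list \<Rightarrow> real) \<Rightarrow> nat set \<Rightarrow> (nat \<Rightarrow> 'w) \<Rightarrow> real" where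
  "gweight nb w F \<sigma> = (\<Prod>a\<in>F. w a (map \<sigma> (nb a)))"

definition partition_fun :: "nat \<Rightarrow> (nat \<Rightarrow> nat list) \<Rightarrow> (nat \<Rightarrow> 'w list \<Rightarrow> real) \<Rightarrow> nat set \<Rightarrow> real" where
  "partition_fun n nb w F = (\<Sum>\<sigma>\<in>configs n. gweight nb w F \<sigma>)"

definition marg1 :: "nat \<Rightarrow> (nat \<Rightarrow> nat list) \<Rightarrow> (nat \<Rightarrow> 'w list \<Rightarrow> real) \<Rightarrow> nat set \<Rightarrow> nat \<Rightarrow> 'w \<Rightarrow> real" where
  "marg1 n nb w F x s = (\<Sum>\<sigma>\<in>{\<sigma>\<in>configs n. \<sigma> x = s}. gweight nb w F \<sigma>) / partition_fun n nb w F"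

definition marg2 :: "nat \<Rightarrow> (nat \<Rightarrow> nat list) \<Rightarrow> (nat \<Rightarrow> 'w list \<Rightarrow> real) \<Rightarrow> nat set \<Rightarrow> nat \<Rightarrow> nat \<Rightarrow> 'w \<times> 'w \<Rightarrow> real" where
  "marg2 n nb w F x y st = (\<Sum>\<sigma>\<in>{\<sigma>\<in>configs n. \<sigma> x = fst st \<and> \<sigma> y = snd st}. gweight nb w F \<sigma>) / partition_fun n nb w F"

definition mu1 :: "nat \<Rightarrow> 'w fgraph \<Rightarrow> nat \<Rightarrow> 'w \<Rightarrow> real" where
  "mu1 n G x = (case G of (m, nb, w) \<Rightarrow> marg1 n nb w {..<m} x)"

definition mu2 :: "nat \<Rightarrow> 'w fgraph \<Rightarrow> nat \<Rightarrow> nat \<Rightarrow> 'w \<times> 'w \<Rightarrow> real" where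
  "mu2 n G x y = (case G of (m, nb, w) \<Rightarrow> marg2 n nb w {..<m} x y)"

definition tv_pair :: "nat \<Rightarrow> 'w::finite fgraph \<Rightarrow> nat \<Rightarrow> nat \<Rightarrow> real" where
  "tv_pair n G x y = (1/2) * (\<Sum>st\<in>(UNIV :: ('w \<times> 'w) set).
      \<bar>mu2 n G x y st - mu1 n G x (fst st) * mu1 n G y (snd st)\<bar>)"

definition var_nbhd :: "nat \<Rightarrow> (nat \<Rightarrow> nat list) \<Rightarrow> nat \<Rightarrow> nat set" where
  "var_nbhd m nb x = {a\<in>{..<m}. x \<in> set (nb a)}"

definition msg_va :: "nat \<Rightarrow> 'w fgraph \<Rightarrow> nat \<Rightarrow> nat \<Rightarrow> 'w \<Rightarrow> real" where
  "msg_va n G x a = (case G of (m, nb, w) \<Rightarrow> marg1 n nb w ({..<m} - {a}) x)"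

definition msg_av :: "nat \<Rightarrow> 'w fgraph \<Rightarrow> nat \<Rightarrow> nat \<Rightarrow> 'w \<Rightarrow> real" where
  "msg_av n G a x = (case G of (m, nb, w) \<Rightarrow>
      marg1 n nb w ({..<m} - (var_nbhd m nb x - {a})) x)"

definition bp_error :: "nat \<Rightarrow> 'w::finite fgraph \<Rightarrow> real" where
  "bp_error n G = (case G of (m, nb, w) \<Rightarrow>
     (\<Sum>x<n. \<Sum>a\<in>var_nbhd m nb x. \<Sum>s\<in>(UNIV :: 'w set).
        \<bar>msg_va n G x a s
          - (\<Prod>b\<in>var_nbhd m nb x - {a}. msg_av n G b x s)
            / (\<Sum>t\<in>UNIV. \<Prod>b\<in>var_nbhd m nb x - {a}. msg_av n G b x t)\<bar>
      + \<bar>msg_av n G a x s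
          - (\<Sum>\<tau>\<in>{\<tau>\<in>PiE (set (nb a)) (\<lambda>_. UNIV). \<tau> x = s}.
               w a (map \<tau> (nb a)) * (\<Prod>y\<in>set (nb a) - {x}. msg_va n G y a (\<tau> y)))
            / (\<Sum>\<tau>\<in>PiE (set (nb a)) (\<lambda>_. UNIV).
               w a (map \<tau> (nb a)) * (\<Prod>y\<in>set (nb a) - {x}. msg_va n G y a (\<tau> y)))\<bar>))"

definition is_bp_fixpoint :: "real \<Rightarrow> nat \<Rightarrow> 'w::finite fgraph \<Rightarrow> bool" where
  "is_bp_fixpoint \<delta> n G \<longleftrightarrow> bp_error n G < \<delta> * real n"

text \<open>psi^J for psi : 'w^k \<rightarrow> (0,\<infinity>) (given on lists of length k, positions 0..k-1) and J \<subseteq> {0..<k}.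
The |J| slots are the elements of J in increasing order, so (sigma_j)_{j\<in>J} is nths tau J.\<close>
definition psi_restrict :: "nat \<Rightarrow> ('w::finite list \<Rightarrow> real) \<Rightarrow> nat set \<Rightarrow> 'w list \<Rightarrow> real" where
  "psi_restrict k psi J ts =
     real CARD('w) powi (int (card J) - int k) *
     (\<Sum>\<tau>\<in>{\<tau>. length \<tau> = k \<and> nths \<tau> J = ts}. psi \<tau>)"

definition J_pmf :: "nat \<Rightarrow> real \<Rightarrow> nat set pmf" where
  "J_pmf k eps = map_pmf (\<lambda>b. {j\<in>{..<k}. b j}) (Pi_pmf {..<k} False (\<lambda>_. bernoulli_pmf (1 - eps)))"

text \<open>Steps REG1, REG2 and the rejection in REG3 (restarting = conditioning on the event).\<close>
definition reg_stage1 :: "nat \<Rightarrow> nat \<Rightarrow> real \<Rightarrow> ('w list \<Rightarrow> real) pmf \<Rightarrow> nat \<Rightarrow> (nat \<times> (nat \<Rightarrow> nat set \<times> ('w list \<Rightarrow> real))) pmf" where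
  "reg_stage1 d k eps \<rho> n =
     cond_pmf
       (bind_pmf (poisson_pmf (real d * real n / real k)) (\<lambda>m.
          map_pmf (\<lambda>c. (m, c)) (Pi_pmf {..<m} undefined (\<lambda>_. pair_pmf (J_pmf k eps) \<rho>))))
       {(m, c). (\<Sum>i<m. card (fst (c i))) \<le> d * n}"

definition slot_assignments :: "nat \<Rightarrow> nat \<Rightarrow> nat \<Rightarrow> (nat \<Rightarrow> nat) \<Rightarrow> (nat \<Rightarrow> nat list) set" where
  "slot_assignments n d m sl =
     {nb \<in> PiE {..<m} (\<lambda>i. {xs. length xs = sl i \<and> set xs \<subseteq> {..<n}}).
        \<forall>x<n. (\<Sum>i<m. count_list (nb i) x) \<le> d}"

definition reg_model :: "nat \<Rightarrow> nat \<Rightarrow> real \<Rightarrow> ('w::finite list \<Rightarrow> real) pmf \<Rightarrow> nat \<Rightarrow> 'w fgraph pmf" where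
  "reg_model d k eps \<rho> n =
     bind_pmf (reg_stage1 d k eps \<rho> n) (\<lambda>(m, c).
       map_pmf (\<lambda>nb. (m, nb, \<lambda>i. psi_restrict k (snd (c i)) (fst (c i))))
         (pmf_of_set (slot_assignments n d m (\<lambda>i. card (fst (c i))))))"

end

theory Submission
  imports Defs
begin

text \<open>
  Fix a factor graph whose Gibbs measure has small average pairwise correlations. By Cauchy--Schwarz,
  every bounded observable is then almost uncorrelated with the spin of a typical variable node.
  This property survives reweighting the Gibbs measure by a function that is bounded above and away
  from zero, so it also holds after the deletion of boundedly many constraint nodes, and by
  induction it extends from one spin to the joint law of the spins on a typical tuple.

  Once all constraint nodes at \<open>x\<close> are deleted, the spin of \<open>x\<close> is uniform and independent of the rest,
  so both Belief Propagation equations at an edge \<open>(x, a)\<close> reduce to an approximate factorisation over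
  \<open>\<partial>a - x\<close>. Given all other neighbour tuples, the tuple of \<open>a\<close> is uniform over a set that contains a
  positive proportion of all tuples, because percolation with \<open>\<epsilon> > 0\<close> leaves linearly many variable
  nodes of degree less than \<open>d\<close> with high probability. Hence the tuple of \<open>a\<close> is typical in the above sense.
\<close>

section \<open>Finitely supported distributions\<close>

definition covariance :: "'a pmf \<Rightarrow> ('a \<Rightarrow> real) \<Rightarrow> ('a \<Rightarrow> real) \<Rightarrow> real" where
  "covariance p f g = measure_pmf.expectation p (\<lambda>x. f x * g x)
     - measure_pmf.expectation p f * measure_pmf.expectation p g"

lemma covariance_commute: "covariance p f g = covariance p g f"
  by (simp add: covariance_def mult.commute)

lemma pmf_map_eq_expectation:
  "pmf (map_pmf g p) t = measure_pmf.expectation p (\<lambda>x. of_bool (g x = t))"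
proof -
  have "(\<lambda>x. of_bool (g x = t) :: real) = indicator (g -` {t})"
    by (auto simp: indicator_def)
  then show ?thesis by (simp add: pmf_map)
qed

locale finite_pmf =
  fixes p :: "'a pmf"
  assumes finite_support: "finite (set_pmf p)"
begin

abbreviation expect :: "('a \<Rightarrow> real) \<Rightarrow> real" where
  "expect \<equiv> measure_pmf.expectation p"

abbreviation cov :: "('a \<Rightarrow> real) \<Rightarrow> ('a \<Rightarrow> real) \<Rightarrow> real" where
  "cov \<equiv> covariance p"

lemma integrable_real [simp, intro]: "integrable (measure_pmf p) (f :: 'a \<Rightarrow> real)"
  by (rule integrable_measure_pmf_finite[OF finite_support])

lemma expect_mono:
  assumes "\<And>x. x \<in> set_pmf p \<Longrightarrow> f x \<le> g x"
  shows "expect f \<le> expect g"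
  using assms by (intro integral_mono_AE integrable_real AE_pmfI)

lemma expect_ge:
  assumes "\<And>x. x \<in> set_pmf p \<Longrightarrow> c \<le> f x"
  shows "c \<le> expect f"
  using expect_mono[of "\<lambda>_. c" f] assms by simp

lemma abs_expect_le:
  assumes "\<And>x. x \<in> set_pmf p \<Longrightarrow> \<bar>f x\<bar> \<le> M"
  shows "\<bar>expect f\<bar> \<le> M"
  using expect_mono[of "\<lambda>x. \<bar>f x\<bar>" "\<lambda>_. M"] assms
  by (intro order_trans[OF integral_abs_bound]) simp

lemma bound_nonneg:
  fixes f :: "'a \<Rightarrow> real"
  assumes "\<And>x. x \<in> set_pmf p \<Longrightarrow> \<bar>f x\<bar> \<le> M"
  shows "0 \<le> M"
  by (rule order_trans[OF abs_ge_zero abs_expect_le]) (rule assms)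

lemma covariance_sum_right:
  "cov f (\<lambda>x. \<Sum>i\<in>I. c i * h i x) = (\<Sum>i\<in>I. c i * cov f (h i))"
  by (simp add: covariance_def sum_distrib_left mult.left_commute sum_subtractf right_diff_distrib)

lemma covariance_self_eq_variance: "cov f f = measure_pmf.variance p f"
  by (subst measure_pmf.variance_eq) (simp_all add: covariance_def power2_eq_square)

lemma expect_square_le: "(expect f)\<^sup>2 \<le> expect (\<lambda>x. (f x)\<^sup>2)"
  using measure_pmf.variance_positive[of p f] by (subst (asm) measure_pmf.variance_eq) simp_all

lemma covariance_square_le:
  assumes "\<And>x. x \<in> set_pmf p \<Longrightarrow> \<bar>f x\<bar> \<le> M"
  shows "(cov f g)\<^sup>2 \<le> M\<^sup>2 * cov g g"
proof -
  let ?g = "\<lambda>x. g x - expect g"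
  have "cov f g = expect (\<lambda>x. f x * ?g x)"
    by (simp add: covariance_def right_diff_distrib)
  also have "(\<dots>)\<^sup>2 \<le> expect (\<lambda>x. (f x * ?g x)\<^sup>2)"
    by (rule expect_square_le)
  also have "\<dots> \<le> expect (\<lambda>x. M\<^sup>2 * (?g x)\<^sup>2)"
  proof (rule expect_mono)
    fix x assume "x \<in> set_pmf p"
    then have "(f x)\<^sup>2 \<le> M\<^sup>2" using assms
      by (simp add: abs_le_square_iff[symmetric] order_trans[OF _ abs_ge_self])
    then show "(f x * ?g x)\<^sup>2 \<le> M\<^sup>2 * (?g x)\<^sup>2"
      by (simp add: power_mult_distrib mult_right_mono)
  qed
  also have "\<dots> = M\<^sup>2 * cov g g"
    by (simp add: covariance_self_eq_variance)
  finally show ?thesis .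
qed

text \<open>Cauchy--Schwarz for \<open>f\<close> and the combination of the \<open>h i\<close> with coefficients \<open>sgn (cov f (h i))\<close>.\<close>

lemma sum_covariance_square_le:
  assumes "\<And>x. x \<in> set_pmf p \<Longrightarrow> \<bar>f x\<bar> \<le> M"
  shows "(\<Sum>i\<in>I. \<bar>cov f (h i)\<bar>)\<^sup>2 \<le> M\<^sup>2 * (\<Sum>i\<in>I. \<Sum>j\<in>I. \<bar>cov (h i) (h j)\<bar>)"
proof -
  define c where "c i = sgn (cov f (h i))" for i
  define g where "g x = (\<Sum>i\<in>I. c i * h i x)" for x
  have abs_c: "\<bar>c i\<bar> \<le> 1" for i
    by (simp add: c_def sgn_real_def)
  have "(\<Sum>i\<in>I. \<bar>cov f (h i)\<bar>) = cov f g"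
    unfolding g_def covariance_sum_right by (simp add: c_def abs_sgn mult.commute)
  then have "(\<Sum>i\<in>I. \<bar>cov f (h i)\<bar>)\<^sup>2 \<le> M\<^sup>2 * cov g g"
    using covariance_square_le[OF assms] by simp
  also have "cov g g \<le> (\<Sum>i\<in>I. \<Sum>j\<in>I. \<bar>cov (h i) (h j)\<bar>)"
  proof -
    have "cov g (h i) = (\<Sum>j\<in>I. c j * cov (h i) (h j))" for i
      unfolding covariance_commute[of p g] g_def covariance_sum_right ..
    then have "cov g g = (\<Sum>i\<in>I. c i * (\<Sum>j\<in>I. c j * cov (h i) (h j)))"
      using covariance_sum_right[of g c h I] by (simp add: g_def[abs_def])
    also have "\<dots> \<le> (\<Sum>i\<in>I. \<Sum>j\<in>I. \<bar>cov (h i) (h j)\<bar>)"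
      unfolding sum_distrib_left
    proof (intro sum_mono)
      fix i j
      have "\<bar>c i * (c j * cov (h i) (h j))\<bar> \<le> 1 * (1 * \<bar>cov (h i) (h j)\<bar>)"
        unfolding abs_mult using abs_c by (intro mult_mono) auto
      then show "c i * (c j * cov (h i) (h j)) \<le> \<bar>cov (h i) (h j)\<bar>" by simp
    qed
    finally show ?thesis .
  qed
  finally show ?thesis by (simp add: mult_left_mono)
qed

lemma expect_prod_approx:
  assumes K_ge_1: "1 \<le> K" and "finite B"
    and f_bound: "\<And>b x. b \<in> B \<Longrightarrow> x \<in> set_pmf p \<Longrightarrow> \<bar>f b x\<bar> \<le> K"
  shows "\<bar>expect (\<lambda>x. \<Prod>b\<in>B. f b x) - (\<Prod>b\<in>B. expect (f b))\<bar>
    \<le> K ^ card B * (\<Sum>b\<in>B. \<Sum>D\<in>Pow (B - {b}). \<bar>cov (\<lambda>x. \<Prod>c\<in>D. f c x) (f b)\<bar>)"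
  using \<open>finite B\<close> f_bound
proof (induction B rule: finite_induct)
  case empty
  then show ?case by simp
next
  case (insert b B)
  let ?cov = "\<lambda>D c. \<bar>cov (\<lambda>x. \<Prod>c\<in>D. f c x) (f c)\<bar>"
  let ?gap = "expect (\<lambda>x. \<Prod>c\<in>B. f c x) - (\<Prod>c\<in>B. expect (f c))"
  let ?covs = "\<lambda>B. \<Sum>c\<in>B. \<Sum>D\<in>Pow (B - {c}). ?cov D c"
  have covs_insert_le: "?cov B b + ?covs B \<le> ?covs (insert b B)"
  proof -
    have "?cov B b \<le> (\<Sum>D\<in>Pow (insert b B - {b}). ?cov D b)"
      using insert.hyps by (intro member_le_sum) auto
    moreover have "?covs B \<le> (\<Sum>c\<in>B. \<Sum>D\<in>Pow (insert b B - {c}). ?cov D c)"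
      using insert.hyps by (intro sum_mono sum_mono2) auto
    ultimately show ?thesis using insert.hyps by simp
  qed
  have "expect (\<lambda>x. \<Prod>c\<in>insert b B. f c x) - (\<Prod>c\<in>insert b B. expect (f c))
    = cov (\<lambda>x. \<Prod>c\<in>B. f c x) (f b) + expect (f b) * ?gap"
    using insert.hyps by (simp add: covariance_def algebra_simps)
  also have "\<bar>\<dots>\<bar> \<le> ?cov B b + K * \<bar>?gap\<bar>"
    using abs_expect_le[of "f b" K] insert.prems
    by (intro order_trans[OF abs_triangle_ineq] add_left_mono) (simp add: abs_mult mult_right_mono)
  also have "\<dots> \<le> K ^ Suc (card B) * ?cov B b + K * (K ^ card B * ?covs B)"
    using mult_right_mono[OF one_le_power[OF K_ge_1, of "Suc (card B)"], of "?cov B b"]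
      insert.IH insert.prems K_ge_1
    by (intro add_mono mult_left_mono) auto
  also have "\<dots> = K ^ Suc (card B) * (?cov B b + ?covs B)"
    by (simp add: algebra_simps)
  also have "\<dots> \<le> K ^ Suc (card B) * ?covs (insert b B)"
    using covs_insert_le K_ge_1 by (intro mult_left_mono) auto
  finally show ?case using insert.hyps by simp
qed

end

section \<open>Spin distributions that are close to products\<close>

lemma sum_PiE_fixed_coordinate:
  assumes "z \<notin> Y"
  shows "(\<Sum>\<tau>\<in>{\<tau> \<in> PiE (insert z Y) (\<lambda>_. UNIV :: 'b set). \<tau> z = t}. \<phi> \<tau>)
    = (\<Sum>\<tau>\<in>PiE Y (\<lambda>_. UNIV). \<phi> (\<tau>(z := t)))"
  by (rule sum.reindex_bij_witness[where i = "\<lambda>\<tau>. \<tau>(z := t)" and j = "\<lambda>\<tau>. \<tau>(z := undefined)"])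
    (use assms in \<open>auto simp: PiE_iff extensional_def fun_eq_iff\<close>)

lemma sum_PiE_insert:
  fixes \<phi> :: "('a \<Rightarrow> 'b::finite) \<Rightarrow> 'c::comm_monoid_add"
  assumes "finite Y" "z \<notin> Y"
  shows "(\<Sum>\<tau>\<in>PiE (insert z Y) (\<lambda>_. UNIV). \<phi> \<tau>) = (\<Sum>t\<in>UNIV. \<Sum>\<tau>\<in>PiE Y (\<lambda>_. UNIV). \<phi> (\<tau>(z := t)))"
  unfolding sum_PiE_fixed_coordinate[OF assms(2), symmetric]
  by (rule sum.group[symmetric]) (use assms in \<open>auto intro: finite_PiE\<close>)

lemma sum_PiE_of_bool_restrict:
  fixes \<phi> :: "('v \<Rightarrow> 'w::finite) \<Rightarrow> 'c::semiring_1"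
  assumes "finite Y"
  shows "(\<Sum>\<tau>\<in>PiE Y (\<lambda>_. UNIV). of_bool (\<forall>y\<in>Y. \<sigma> y = \<tau> y) * \<phi> \<tau>) = \<phi> (restrict \<sigma> Y)"
proof -
  have "(\<Sum>\<tau>\<in>PiE Y (\<lambda>_. UNIV). of_bool (\<forall>y\<in>Y. \<sigma> y = \<tau> y) * \<phi> \<tau>)
    = (\<Sum>\<tau>\<in>PiE Y (\<lambda>_. UNIV). if \<tau> = restrict \<sigma> Y then \<phi> (restrict \<sigma> Y) else 0)"
  proof (rule sum.cong[OF refl])
    fix \<tau> :: "'v \<Rightarrow> 'w" assume "\<tau> \<in> PiE Y (\<lambda>_. UNIV)"
    then have "(\<forall>y\<in>Y. \<sigma> y = \<tau> y) \<longleftrightarrow> \<tau> = restrict \<sigma> Y"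
      by (auto simp: fun_eq_iff restrict_def PiE_def extensional_def)
    then show "of_bool (\<forall>y\<in>Y. \<sigma> y = \<tau> y) * \<phi> \<tau> = (if \<tau> = restrict \<sigma> Y then \<phi> (restrict \<sigma> Y) else 0)"
      by simp
  qed
  also have "\<dots> = \<phi> (restrict \<sigma> Y)"
    using assms by (subst sum.delta) (auto simp: finite_PiE)
  finally show ?thesis .
qed

lemma sum_prod_pmf_PiE:
  fixes v :: "'v \<Rightarrow> 'w::finite pmf"
  assumes "finite Y"
  shows "(\<Sum>\<tau>\<in>PiE Y (\<lambda>_. UNIV). \<Prod>y\<in>Y. pmf (v y) (\<tau> y)) = 1"
proof -
  have "(\<Sum>\<tau>\<in>PiE Y (\<lambda>_. UNIV). \<Prod>y\<in>Y. pmf (v y) (\<tau> y)) = (\<Prod>y\<in>Y. \<Sum>t\<in>UNIV. pmf (v y) t)"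
    using assms by (simp add: prod_sum_PiE)
  also have "\<dots> = 1"
    by (simp add: sum_pmf_eq_1)
  finally show ?thesis .
qed

definition product_deviation ::
    "('v \<Rightarrow> 'w::finite) pmf \<Rightarrow> ('v \<Rightarrow> 'w pmf) \<Rightarrow> (('v \<Rightarrow> 'w) \<Rightarrow> real) \<Rightarrow> 'v set \<Rightarrow> real" where
  "product_deviation p v f Y = (\<Sum>\<tau>\<in>PiE Y (\<lambda>_. UNIV).
     \<bar>measure_pmf.expectation p (\<lambda>\<sigma>. f \<sigma> * of_bool (\<forall>y\<in>Y. \<sigma> y = \<tau> y))
       - measure_pmf.expectation p f * (\<Prod>y\<in>Y. pmf (v y) (\<tau> y))\<bar>)"

abbreviation marginals :: "('v \<Rightarrow> 'w) pmf \<Rightarrow> 'v \<Rightarrow> 'w pmf" where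
  "marginals p \<equiv> (\<lambda>y. map_pmf (\<lambda>\<sigma>. \<sigma> y) p)"

text \<open>The reference distributions \<open>v\<close> need not be the marginals of \<open>p\<close>: keeping them fixed is what
  makes the property stable under reweighting.\<close>

definition mixing ::
    "'v set \<Rightarrow> ('v \<Rightarrow> 'w::finite) pmf \<Rightarrow> ('v \<Rightarrow> 'w pmf) \<Rightarrow> real \<Rightarrow> bool" where
  "mixing V p v \<eta> \<longleftrightarrow> (\<forall>f M. (\<forall>\<sigma>\<in>set_pmf p. \<bar>f \<sigma>\<bar> \<le> M) \<longrightarrow>
     (\<Sum>y\<in>V. product_deviation p v f {y}) \<le> M * \<eta> * real (card V))"

lemma mixingI:
  assumes "\<And>f M. (\<And>\<sigma>. \<sigma> \<in> set_pmf p \<Longrightarrow> \<bar>f \<sigma>\<bar> \<le> M) \<Longrightarrow>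
    (\<Sum>y\<in>V. product_deviation p v f {y}) \<le> M * \<eta> * real (card V)"
  shows "mixing V p v \<eta>"
  using assms unfolding mixing_def by blast

lemma mixingD:
  assumes "mixing V p v \<eta>" "\<And>\<sigma>. \<sigma> \<in> set_pmf p \<Longrightarrow> \<bar>f \<sigma>\<bar> \<le> M"
  shows "(\<Sum>y\<in>V. product_deviation p v f {y}) \<le> M * \<eta> * real (card V)"
  using assms unfolding mixing_def by blast

lemma product_deviation_nonneg [simp]: "0 \<le> product_deviation p v f Y"
  by (simp add: product_deviation_def sum_nonneg)

lemma product_deviation_singleton:
  "product_deviation p v f {z} = (\<Sum>t\<in>UNIV.
     \<bar>measure_pmf.expectation p (\<lambda>\<sigma>. f \<sigma> * of_bool (\<sigma> z = t))
       - measure_pmf.expectation p f * pmf (v z) t\<bar>)"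
  unfolding product_deviation_def by (subst sum_PiE_insert) simp_all

lemma product_deviation_tilt:
  assumes tilt: "\<And>g. measure_pmf.expectation q g
      = measure_pmf.expectation p (\<lambda>\<sigma>. g \<sigma> * r \<sigma>) / measure_pmf.expectation p r"
    and normalizer_pos: "0 < measure_pmf.expectation p r"
  shows "product_deviation q v f Y
    = product_deviation p v (\<lambda>\<sigma>. f \<sigma> * r \<sigma>) Y / measure_pmf.expectation p r"
  unfolding product_deviation_def tilt sum_divide_distrib
  using normalizer_pos by (intro sum.cong refl) (simp add: mult_ac flip: diff_divide_distrib)

locale spin_distribution = finite_pmf p for p :: "('v \<Rightarrow> 'w::finite) pmf"
begin

lemma product_deviation_insert:
  assumes "finite Y" "z \<notin> Y"
  shows "product_deviation p v f (insert z Y)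
    \<le> (\<Sum>t\<in>UNIV. product_deviation p v (\<lambda>\<sigma>. f \<sigma> * of_bool (\<sigma> z = t)) Y) + product_deviation p v f {z}"
proof -
  let ?P = "PiE Y (\<lambda>_. UNIV) :: ('v \<Rightarrow> 'w) set" and ?pr = "\<lambda>\<tau>. \<Prod>y\<in>Y. pmf (v y) (\<tau> y)"
  define fz where "fz t = (\<lambda>\<sigma>. f \<sigma> * of_bool (\<sigma> z = t))" for t
  define gap where "gap t = \<bar>expect (fz t) - expect f * pmf (v z) t\<bar>" for t
  define E where "E t \<tau> = expect (\<lambda>\<sigma>. fz t \<sigma> * of_bool (\<forall>y\<in>Y. \<sigma> y = \<tau> y))" for t \<tau>
  have off_coordinate: "(\<forall>y\<in>Y. \<sigma> y = (\<tau>(z := t)) y) \<longleftrightarrow> (\<forall>y\<in>Y. \<sigma> y = \<tau> y)"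
      "(\<Prod>y\<in>Y. pmf (v y) ((\<tau>(z := t)) y)) = ?pr \<tau>" for \<sigma> \<tau> :: "'v \<Rightarrow> 'w" and t
    using assms(2) by (auto intro!: prod.cong)
  have "product_deviation p v f (insert z Y)
    = (\<Sum>t\<in>UNIV. \<Sum>\<tau>\<in>?P. \<bar>E t \<tau> - expect f * pmf (v z) t * ?pr \<tau>\<bar>)"
    unfolding product_deviation_def sum_PiE_insert[OF assms]
    using assms
    by (intro sum.cong refl)
      (simp add: E_def fz_def off_coordinate of_bool_conj mult_ac fun_upd_same del: fun_upd_apply)
  also have "\<dots> \<le> (\<Sum>t\<in>UNIV. \<Sum>\<tau>\<in>?P. \<bar>E t \<tau> - expect (fz t) * ?pr \<tau>\<bar> + gap t * ?pr \<tau>)"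
  proof (intro sum_mono)
    fix t \<tau>
    have "gap t * ?pr \<tau> = \<bar>expect (fz t) * ?pr \<tau> - expect f * pmf (v z) t * ?pr \<tau>\<bar>"
      by (simp add: gap_def abs_mult prod_nonneg flip: left_diff_distrib)
    then show "\<bar>E t \<tau> - expect f * pmf (v z) t * ?pr \<tau>\<bar>
      \<le> \<bar>E t \<tau> - expect (fz t) * ?pr \<tau>\<bar> + gap t * ?pr \<tau>"
      by linarith
  qed
  also have "\<dots> = (\<Sum>t\<in>UNIV. product_deviation p v (fz t) Y) + (\<Sum>t\<in>UNIV. gap t)"
    by (simp add: sum.distrib product_deviation_def E_def sum_prod_pmf_PiE[OF assms(1)]
        flip: sum_distrib_left)
  also have "(\<Sum>t\<in>UNIV. gap t) = product_deviation p v f {z}"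
    by (simp add: product_deviation_singleton gap_def fz_def)
  finally show ?thesis unfolding fz_def .
qed

lemma expect_local_approx:
  assumes "finite Y" and local: "\<And>\<sigma>. \<phi> (restrict \<sigma> Y) = \<phi> \<sigma>" and "\<And>\<sigma>. \<bar>\<phi> \<sigma>\<bar> \<le> K"
  shows "\<bar>expect (\<lambda>\<sigma>. f \<sigma> * \<phi> \<sigma>) - expect f * (\<Sum>\<tau>\<in>PiE Y (\<lambda>_. UNIV). \<phi> \<tau> * (\<Prod>y\<in>Y. pmf (v y) (\<tau> y)))\<bar>
    \<le> K * product_deviation p v f Y"
proof -
  let ?P = "PiE Y (\<lambda>_. UNIV) :: ('v \<Rightarrow> 'w) set" and ?pr = "\<lambda>\<tau>. \<Prod>y\<in>Y. pmf (v y) (\<tau> y)"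
  let ?E = "\<lambda>\<tau>. expect (\<lambda>\<sigma>. f \<sigma> * of_bool (\<forall>y\<in>Y. \<sigma> y = \<tau> y))"
  have "expect (\<lambda>\<sigma>. f \<sigma> * \<phi> \<sigma>) = expect (\<lambda>\<sigma>. \<Sum>\<tau>\<in>?P. \<phi> \<tau> * (f \<sigma> * of_bool (\<forall>y\<in>Y. \<sigma> y = \<tau> y)))"
  proof (rule arg_cong[where f = expect], rule ext)
    fix \<sigma>
    show "f \<sigma> * \<phi> \<sigma> = (\<Sum>\<tau>\<in>?P. \<phi> \<tau> * (f \<sigma> * of_bool (\<forall>y\<in>Y. \<sigma> y = \<tau> y)))"
      unfolding local[symmetric, of \<sigma>] sum_PiE_of_bool_restrict[OF assms(1), symmetric]
      by (simp only: sum_distrib_left mult_ac)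
  qed
  also have "\<dots> = (\<Sum>\<tau>\<in>?P. \<phi> \<tau> * ?E \<tau>)"
    by simp
  finally have "expect (\<lambda>\<sigma>. f \<sigma> * \<phi> \<sigma>) - expect f * (\<Sum>\<tau>\<in>?P. \<phi> \<tau> * ?pr \<tau>)
    = (\<Sum>\<tau>\<in>?P. \<phi> \<tau> * (?E \<tau> - expect f * ?pr \<tau>))"
    by (simp only: sum_distrib_left sum_subtractf right_diff_distrib mult_ac)
  also have "\<bar>\<dots>\<bar> \<le> (\<Sum>\<tau>\<in>?P. K * \<bar>?E \<tau> - expect f * ?pr \<tau>\<bar>)"
    by (intro order_trans[OF sum_abs] sum_mono) (auto simp: abs_mult intro!: mult_right_mono assms)
  finally show ?thesis by (simp add: product_deviation_def sum_distrib_left)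
qed

lemma covariance_local_le:
  assumes "finite Y" "\<And>\<sigma>. \<phi> (restrict \<sigma> Y) = \<phi> \<sigma>" "\<And>\<sigma>. \<bar>\<phi> \<sigma>\<bar> \<le> K"
    and f_bound: "\<And>\<sigma>. \<sigma> \<in> set_pmf p \<Longrightarrow> \<bar>f \<sigma>\<bar> \<le> M"
  shows "\<bar>cov f \<phi>\<bar> \<le> K * (product_deviation p v f Y + M * product_deviation p v (\<lambda>_. 1) Y)"
proof -
  define S where "S = (\<Sum>\<tau>\<in>PiE Y (\<lambda>_. UNIV). \<phi> \<tau> * (\<Prod>y\<in>Y. pmf (v y) (\<tau> y)))"
  have "\<bar>expect (\<lambda>\<sigma>. f \<sigma> * \<phi> \<sigma>) - expect f * S\<bar> \<le> K * product_deviation p v f Y"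
    unfolding S_def by (rule expect_local_approx[where \<phi> = \<phi>, OF assms(1-3)])
  moreover have "\<bar>expect f * (expect \<phi> - S)\<bar> \<le> M * (K * product_deviation p v (\<lambda>_. 1) Y)"
    unfolding abs_mult S_def
    using expect_local_approx[where \<phi> = \<phi>, OF assms(1-3), of "\<lambda>_. 1" v]
      abs_expect_le[of f M] bound_nonneg[of f M] f_bound
    by (intro mult_mono) auto
  moreover have "cov f \<phi> = (expect (\<lambda>\<sigma>. f \<sigma> * \<phi> \<sigma>) - expect f * S) - expect f * (expect \<phi> - S)"
    by (simp add: covariance_def algebra_simps)
  ultimately show ?thesis by (simp add: algebra_simps)
qed

lemma mixing_tilt:
  assumes mixing: "mixing V p v \<eta>"
    and tilt: "\<And>g. measure_pmf.expectation q g = expect (\<lambda>\<sigma>. g \<sigma> * r \<sigma>) / expect r"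
    and support: "set_pmf q = set_pmf p"
    and R_pos: "0 < R" and r_bounds: "\<And>\<sigma>. \<sigma> \<in> set_pmf p \<Longrightarrow> 1 / R \<le> r \<sigma> \<and> r \<sigma> \<le> R"
  shows "mixing V q v (R\<^sup>2 * \<eta>)"
proof (rule mixingI)
  fix f :: "('v \<Rightarrow> 'w) \<Rightarrow> real" and M
  assume f_bound: "\<And>\<sigma>. \<sigma> \<in> set_pmf q \<Longrightarrow> \<bar>f \<sigma>\<bar> \<le> M"
  have expect_r_ge: "1 / R \<le> expect r"
    by (rule expect_ge) (use r_bounds in blast)
  then have expect_r_pos: "0 < expect r"
    using R_pos by (meson less_le_trans zero_less_divide_1_iff)
  then have inverse_le: "1 / expect r \<le> R"
    using expect_r_ge R_pos by (simp add: field_simps)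
  have "\<bar>f \<sigma> * r \<sigma>\<bar> \<le> M * R" if "\<sigma> \<in> set_pmf p" for \<sigma>
  proof -
    have "0 \<le> r \<sigma>" using r_bounds[OF that] R_pos
      by (meson divide_nonneg_pos order_trans zero_le_one)
    then show ?thesis
      unfolding abs_mult using f_bound[unfolded support, OF that] r_bounds[OF that]
      by (intro mult_mono) auto
  qed
  then have deviation_le: "(\<Sum>y\<in>V. product_deviation p v (\<lambda>\<sigma>. f \<sigma> * r \<sigma>) {y}) \<le> M * R * \<eta> * real (card V)"
    by (rule mixingD[OF mixing])
  have "(\<Sum>y\<in>V. product_deviation q v f {y})
    = (\<Sum>y\<in>V. product_deviation p v (\<lambda>\<sigma>. f \<sigma> * r \<sigma>) {y}) * (1 / expect r)"
    by (simp add: product_deviation_tilt[OF tilt expect_r_pos] sum_divide_distrib)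
  also have "\<dots> \<le> (M * R * \<eta> * real (card V)) * R"
    using expect_r_pos inverse_le
    by (intro mult_mono deviation_le order_trans[OF sum_nonneg deviation_le]) auto
  finally show "(\<Sum>y\<in>V. product_deviation q v f {y}) \<le> M * (R\<^sup>2 * \<eta>) * real (card V)"
    by (simp add: power2_eq_square mult_ac)
qed

lemma product_deviation_marginals_le:
  assumes "\<And>\<sigma>. \<sigma> \<in> set_pmf p \<Longrightarrow> \<bar>f \<sigma>\<bar> \<le> M"
  shows "product_deviation p (marginals p) f {y}
    \<le> product_deviation p v f {y} + M * product_deviation p v (\<lambda>_. 1) {y}"
  unfolding product_deviation_singleton sum_distrib_left sum.distrib[symmetric]
proof (rule sum_mono)
  fix t
  let ?f = "expect (\<lambda>\<sigma>. f \<sigma> * of_bool (\<sigma> y = t))" and ?p = "expect (\<lambda>\<sigma>. of_bool (\<sigma> y = t))"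
  have "\<bar>expect f * (?p - pmf (v y) t)\<bar> \<le> M * \<bar>?p - pmf (v y) t\<bar>"
    unfolding abs_mult using abs_expect_le[of f M] assms by (intro mult_right_mono) auto
  then show "\<bar>?f - expect f * pmf (marginals p y) t\<bar>
    \<le> \<bar>?f - expect f * pmf (v y) t\<bar>
      + M * \<bar>expect (\<lambda>\<sigma>. 1 * of_bool (\<sigma> y = t)) - expect (\<lambda>_. 1) * pmf (v y) t\<bar>"
    by (simp add: pmf_map_eq_expectation right_diff_distrib)
qed

lemma mixing_marginals:
  assumes "mixing V p v \<eta>"
  shows "mixing V p (marginals p) (2 * \<eta>)"
proof (rule mixingI)
  fix f :: "('v \<Rightarrow> 'w) \<Rightarrow> real" and M
  assume f_bound: "\<And>\<sigma>. \<sigma> \<in> set_pmf p \<Longrightarrow> \<bar>f \<sigma>\<bar> \<le> M"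
  have "(\<Sum>y\<in>V. product_deviation p (marginals p) f {y})
    \<le> (\<Sum>y\<in>V. product_deviation p v f {y} + M * product_deviation p v (\<lambda>_. 1) {y})"
    by (rule sum_mono) (rule product_deviation_marginals_le[OF f_bound])
  also have "\<dots> = (\<Sum>y\<in>V. product_deviation p v f {y}) + M * (\<Sum>y\<in>V. product_deviation p v (\<lambda>_. 1) {y})"
    by (simp add: sum.distrib sum_distrib_left)
  also have "\<dots> \<le> M * \<eta> * real (card V) + M * (1 * \<eta> * real (card V))"
    using bound_nonneg[of f M] f_bound by (intro add_mono mult_left_mono mixingD[OF assms]) auto
  finally show "(\<Sum>y\<in>V. product_deviation p (marginals p) f {y}) \<le> M * (2 * \<eta>) * real (card V)"
    by simp
qed

lemma mixing_of_small_covariances: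
  assumes covariances_le: "\<And>t. (\<Sum>x\<in>V. \<Sum>y\<in>V. \<bar>cov (\<lambda>\<sigma>. of_bool (\<sigma> x = t)) (\<lambda>\<sigma>. of_bool (\<sigma> y = t))\<bar>)
      \<le> \<delta> * (real (card V))\<^sup>2"
  shows "mixing V p (marginals p) (real CARD('w) * sqrt \<delta>)"
proof (rule mixingI)
  fix f :: "('v \<Rightarrow> 'w) \<Rightarrow> real" and M
  assume f_bound: "\<And>\<sigma>. \<sigma> \<in> set_pmf p \<Longrightarrow> \<bar>f \<sigma>\<bar> \<le> M"
  let ?spin = "\<lambda>t y \<sigma>. of_bool (\<sigma> y = t) :: real"
  have spin_covariances_le: "(\<Sum>y\<in>V. \<bar>cov f (?spin t y)\<bar>) \<le> M * (sqrt \<delta> * real (card V))" for t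
  proof -
    have "(\<Sum>y\<in>V. \<bar>cov f (?spin t y)\<bar>)\<^sup>2 \<le> M\<^sup>2 * (\<delta> * (real (card V))\<^sup>2)"
      by (rule order_trans[OF sum_covariance_square_le[OF f_bound] mult_left_mono[OF covariances_le]]) auto
    then show ?thesis
      using real_le_rsqrt bound_nonneg[of f M] f_bound by (fastforce simp: real_sqrt_mult)
  qed
  have "(\<Sum>y\<in>V. product_deviation p (marginals p) f {y}) = (\<Sum>t\<in>UNIV. \<Sum>y\<in>V. \<bar>cov f (?spin t y)\<bar>)"
    by (subst sum.swap) (simp add: product_deviation_singleton covariance_def pmf_map_eq_expectation)
  also have "\<dots> \<le> (\<Sum>t\<in>(UNIV :: 'w set). M * (sqrt \<delta> * real (card V)))"
    by (rule sum_mono) (rule spin_covariances_le)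
  finally show "(\<Sum>y\<in>V. product_deviation p (marginals p) f {y})
    \<le> M * (real CARD('w) * sqrt \<delta>) * real (card V)"
    by (simp add: mult_ac)
qed

end

section \<open>Typical tuples\<close>

abbreviation tuples :: "'a set \<Rightarrow> nat \<Rightarrow> 'a list set" where
  "tuples V l \<equiv> {xs. set xs \<subseteq> V \<and> length xs = l}"

lemma sum_tuples_insert_nth:
  assumes "i \<le> l"
  shows "(\<Sum>ys\<in>tuples V (Suc l). \<phi> ys) = (\<Sum>x\<in>V. \<Sum>zs\<in>tuples V l. \<phi> (take i zs @ x # drop i zs))"
proof -
  have "(\<Sum>ys\<in>tuples V (Suc l). \<phi> ys) = (\<Sum>(x, zs)\<in>V \<times> tuples V l. \<phi> (take i zs @ x # drop i zs))"
  proof (rule sum.reindex_bij_witness[where i = "\<lambda>(x, zs). take i zs @ x # drop i zs"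
        and j = "\<lambda>ys. (ys ! i, take i ys @ drop (Suc i) ys)"], goal_cases)
    case (2 ys)
    then have "ys ! i \<in> V" using assms by (auto intro: nth_mem)
    then show ?case
      using 2 assms by (auto dest: in_set_takeD in_set_dropD)
  qed (use assms in \<open>auto simp: id_take_nth_drop[symmetric] nth_append dest: in_set_takeD in_set_dropD\<close>)
  then show ?thesis by (simp add: sum.cartesian_product)
qed

lemma sum_tuples_members_le:
  fixes \<psi> :: "'a \<Rightarrow> 'a set \<Rightarrow> real"
  assumes nonneg: "\<And>x Y. 0 \<le> \<psi> x Y"
  shows "(\<Sum>ys\<in>tuples V (Suc l). \<Sum>x\<in>set ys. \<psi> x (set ys - {x}))
    \<le> real (Suc l) * (\<Sum>x\<in>V. \<Sum>zs\<in>tuples V l. \<psi> x (set zs - {x}))"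
proof -
  have members_le_positions: "(\<Sum>x\<in>set ys. \<psi> x (set ys - {x})) \<le> (\<Sum>i\<le>l. \<psi> (ys ! i) (set ys - {ys ! i}))"
    if "ys \<in> tuples V (Suc l)" for ys
  proof -
    have "set ys = (!) ys ` {..l}"
      using that by (auto simp: set_conv_nth less_Suc_eq_le)
    then have "(\<Sum>x\<in>set ys. \<psi> x (set ys - {x})) = (\<Sum>x\<in>(!) ys ` {..l}. \<psi> x (set ys - {x}))"
      by simp
    also have "\<dots> \<le> (\<Sum>i\<le>l. \<psi> (ys ! i) (set ys - {ys ! i}))"
      using sum_image_le[of "{..l}" "\<lambda>x. \<psi> x (set ys - {x})" "(!) ys"] nonneg by (simp add: o_def)
    finally show ?thesis .
  qed
  have position_eq: "(\<Sum>ys\<in>tuples V (Suc l). \<psi> (ys ! i) (set ys - {ys ! i}))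
      = (\<Sum>x\<in>V. \<Sum>zs\<in>tuples V l. \<psi> x (set zs - {x}))" if "i \<le> l" for i
    unfolding sum_tuples_insert_nth[OF that]
  proof (intro sum.cong refl)
    fix x zs assume "zs \<in> tuples V l"
    moreover have "set (take i zs) \<union> set (drop i zs) = set zs"
      by (metis append_take_drop_id set_append)
    ultimately show "\<psi> ((take i zs @ x # drop i zs) ! i)
        (set (take i zs @ x # drop i zs) - {(take i zs @ x # drop i zs) ! i}) = \<psi> x (set zs - {x})"
      using that by (simp add: nth_append)
  qed
  have "(\<Sum>ys\<in>tuples V (Suc l). \<Sum>x\<in>set ys. \<psi> x (set ys - {x}))
    \<le> (\<Sum>i\<le>l. \<Sum>ys\<in>tuples V (Suc l). \<psi> (ys ! i) (set ys - {ys ! i}))"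
    by (subst sum.swap) (rule sum_mono, rule members_le_positions)
  also have "\<dots> = real (Suc l) * (\<Sum>x\<in>V. \<Sum>zs\<in>tuples V l. \<psi> x (set zs - {x}))"
    by (simp add: position_eq)
  finally show ?thesis .
qed

context spin_distribution
begin

lemma product_deviation_Cons_le:
  "product_deviation p v f (set (z # zs) - X)
    \<le> (\<Sum>t\<in>UNIV. product_deviation p v (\<lambda>\<sigma>. f \<sigma> * of_bool (\<sigma> z = t)) (set zs - X))
      + product_deviation p v f {z} + product_deviation p v f (set zs - X)"
proof (cases "z \<in> X \<union> set zs")
  case True
  then have "set (z # zs) - X = set zs - X" by auto
  then show ?thesis by (simp add: sum_nonneg)
next
  case False
  then have "set (z # zs) - X = insert z (set zs - X)" by auto
  then show ?thesis
    using product_deviation_insert[of "set zs - X" z v f] False by (simp add: add_increasing2)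
qed

text \<open>The set \<open>set zs - X\<close> forgets repetitions, so tuples with repeated entries need no separate
  treatment.\<close>

lemma sum_product_deviation_tuples_le:
  assumes finite_V: "finite V" and mixing: "mixing V p v \<eta>" and \<eta>_nonneg: "0 \<le> \<eta>"
    and f_bound: "\<And>\<sigma>. \<sigma> \<in> set_pmf p \<Longrightarrow> \<bar>f \<sigma>\<bar> \<le> M"
  shows "(\<Sum>zs\<in>tuples V l. product_deviation p v f (set zs - X))
    \<le> M * \<eta> * (real CARD('w) + 2) ^ l * real (card V) ^ l"
  using f_bound
proof (induction l arbitrary: f)
  case 0
  have "tuples V 0 = {[]}" by auto
  then show ?case using bound_nonneg[of f M] 0 \<eta>_nonneg by (simp add: product_deviation_def)
next
  case (Suc l)
  let ?q = "real CARD('w)" and ?N = "real (card V)" and ?dev = "product_deviation p v"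
  let ?fz = "\<lambda>z t \<sigma>. f \<sigma> * of_bool (\<sigma> z = t)"
  define B where "B = M * \<eta> * (?q + 2) ^ l * ?N ^ l"
  have M_nonneg: "0 \<le> M" using bound_nonneg[of f M] Suc.prems by blast
  have B_ge: "M * \<eta> * ?N ^ l \<le> B"
    using M_nonneg \<eta>_nonneg mult_left_mono[of 1 "(?q + 2) ^ l" "M * \<eta> * ?N ^ l"]
    by (simp add: B_def mult_ac)
  have shorter_tuples_le: "(\<Sum>zs\<in>tuples V l. ?dev (?fz z t) (set zs - X)) \<le> B"
      "(\<Sum>zs\<in>tuples V l. ?dev f (set zs - X)) \<le> B" for z t
    unfolding B_def using Suc.prems M_nonneg by (auto intro!: Suc.IH simp: of_bool_def)
  have "(\<Sum>ys\<in>tuples V (Suc l). ?dev f (set ys - X))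
    = (\<Sum>z\<in>V. \<Sum>zs\<in>tuples V l. ?dev f (set (z # zs) - X))"
    by (subst sum_tuples_insert_nth[of 0]) simp_all
  also have "\<dots> \<le> (\<Sum>z\<in>V. \<Sum>zs\<in>tuples V l.
      (\<Sum>t\<in>UNIV. ?dev (?fz z t) (set zs - X)) + ?dev f {z} + ?dev f (set zs - X))"
    by (intro sum_mono product_deviation_Cons_le)
  also have "\<dots> = (\<Sum>z\<in>V. \<Sum>t\<in>UNIV. \<Sum>zs\<in>tuples V l. ?dev (?fz z t) (set zs - X))
      + ?N ^ l * (\<Sum>z\<in>V. ?dev f {z}) + (\<Sum>z\<in>V. \<Sum>zs\<in>tuples V l. ?dev f (set zs - X))"
    using finite_V
    by (simp add: sum.distrib sum_distrib_left sum.swap[of _ UNIV "tuples V l"] card_lists_length_eq)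
  also have "\<dots> \<le> (\<Sum>z\<in>V. \<Sum>t\<in>(UNIV :: 'w set). B) + ?N ^ l * (M * \<eta> * ?N) + (\<Sum>z\<in>V. B)"
    using shorter_tuples_le
    by (intro add_mono sum_mono mult_left_mono mixingD[OF mixing] Suc.prems) auto
  also have "\<dots> = ?N * (?q * B + M * \<eta> * ?N ^ l + B)"
    by (simp add: algebra_simps)
  also have "\<dots> \<le> ?N * (?q * B + B + B)"
    using B_ge by (intro mult_left_mono add_mono) auto
  also have "\<dots> = M * \<eta> * (?q + 2) ^ Suc l * ?N ^ Suc l"
    by (simp add: B_def algebra_simps)
  finally show ?case .
qed

end

section \<open>Gibbs measures\<close>

definition positive_on :: "(nat \<Rightarrow> nat list) \<Rightarrow> (nat \<Rightarrow> 'w list \<Rightarrow> real) \<Rightarrow> nat set \<Rightarrow> bool" where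
  "positive_on nb w F \<longleftrightarrow> (\<forall>a\<in>F. \<forall>\<sigma>. 0 < w a (map \<sigma> (nb a)))"

definition gibbs_pmf ::
    "nat \<Rightarrow> (nat \<Rightarrow> nat list) \<Rightarrow> (nat \<Rightarrow> 'w list \<Rightarrow> real) \<Rightarrow> nat set \<Rightarrow> (nat \<Rightarrow> 'w) pmf" where
  "gibbs_pmf n nb w F =
     embed_pmf (\<lambda>\<sigma>. of_bool (\<sigma> \<in> configs n) * gweight nb w F \<sigma> / partition_fun n nb w F)"

lemma finite_configs [simp]: "finite (configs n :: (nat \<Rightarrow> 'w::finite) set)"
  by (simp add: configs_def finite_PiE)

lemma configs_nonempty [simp]: "configs n \<noteq> ({} :: (nat \<Rightarrow> 'w) set)"
  by (simp add: configs_def PiE_eq_empty_iff)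

lemma sum_configs_fun_upd:
  fixes \<phi> :: "(nat \<Rightarrow> 'w::finite) \<Rightarrow> real"
  assumes "x < n"
  shows "(\<Sum>\<sigma>\<in>configs n. \<phi> (\<sigma>(x := s))) = real CARD('w) * (\<Sum>\<sigma>\<in>{\<sigma>\<in>configs n. \<sigma> x = s}. \<phi> \<sigma>)"
proof -
  let ?Y = "{..<n} - {x}"
  have "configs n = PiE (insert x ?Y) (\<lambda>_. UNIV :: 'w set)"
    using assms by (simp add: configs_def insert_absorb)
  then show ?thesis
    using sum_PiE_insert[of ?Y x "\<lambda>\<sigma>. \<phi> (\<sigma>(x := s))"]
      sum_PiE_fixed_coordinate[where z = x and Y = ?Y and t = s and \<phi> = \<phi>] by simp
qed

lemma gweight_singleton [simp]: "gweight nb w {a} \<sigma> = w a (map \<sigma> (nb a))"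
  by (simp add: gweight_def)

lemma gweight_union:
  "finite F \<Longrightarrow> finite B \<Longrightarrow> F \<inter> B = {} \<Longrightarrow> gweight nb w (F \<union> B) \<sigma> = gweight nb w F \<sigma> * gweight nb w B \<sigma>"
  unfolding gweight_def by (rule prod.union_disjoint)

lemma gweight_resample: "a \<notin> F \<Longrightarrow> gweight (nb(a := ys)) w F = gweight nb w F"
  unfolding gweight_def by (intro ext prod.cong) auto

lemma gibbs_pmf_resample: "a \<notin> F \<Longrightarrow> gibbs_pmf n (nb(a := ys)) w F = gibbs_pmf n nb w F"
  unfolding gibbs_pmf_def partition_fun_def by (simp add: gweight_resample)

lemma gweight_pos: "positive_on nb w F \<Longrightarrow> 0 < gweight nb w F \<sigma>"
  unfolding positive_on_def gweight_def by (intro prod_pos) auto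

context
  fixes n :: nat and nb :: "nat \<Rightarrow> nat list" and w :: "nat \<Rightarrow> 'w::finite list \<Rightarrow> real" and F :: "nat set"
  assumes positive: "positive_on nb w F"
begin

lemma partition_fun_pos: "0 < partition_fun n nb w F"
  unfolding partition_fun_def using positive by (intro sum_pos gweight_pos) auto

lemma pmf_gibbs: "pmf (gibbs_pmf n nb w F) \<sigma>
  = of_bool (\<sigma> \<in> configs n) * gweight nb w F \<sigma> / partition_fun n nb w F"
  unfolding gibbs_pmf_def
proof (rule pmf_embed_pmf)
  let ?g = "\<lambda>\<sigma>. of_bool (\<sigma> \<in> configs n) * gweight nb w F \<sigma> / partition_fun n nb w F"
  show "0 \<le> ?g \<sigma>" for \<sigma>
    using gweight_pos[OF positive] partition_fun_pos by (simp add: less_imp_le)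
  have "(\<integral>\<^sup>+\<sigma>. ennreal (?g \<sigma>) \<partial>count_space UNIV) = (\<Sum>\<sigma>\<in>configs n. ennreal (?g \<sigma>))"
    by (rule nn_integral_count_space') (auto simp: not_less)
  also have "\<dots> = ennreal ((\<Sum>\<sigma>\<in>configs n. gweight nb w F \<sigma>) / partition_fun n nb w F)"
    using gweight_pos[OF positive] partition_fun_pos by (simp add: sum_divide_distrib less_imp_le)
  also have "\<dots> = 1"
    using partition_fun_pos by (simp add: partition_fun_def)
  finally show "(\<integral>\<^sup>+\<sigma>. ennreal (?g \<sigma>) \<partial>count_space UNIV) = 1" .
qed

lemma set_pmf_gibbs: "set_pmf (gibbs_pmf n nb w F) = configs n"
  using gweight_pos[OF positive] partition_fun_pos
  by (auto simp: set_pmf_eq pmf_gibbs less_imp_neq[THEN not_sym])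

lemma spin_distribution_gibbs: "spin_distribution (gibbs_pmf n nb w F)"
  by unfold_locales (simp add: set_pmf_gibbs)

lemma expectation_gibbs: "measure_pmf.expectation (gibbs_pmf n nb w F) f
  = (\<Sum>\<sigma>\<in>configs n. gweight nb w F \<sigma> * f \<sigma>) / partition_fun n nb w F"
  by (subst integral_measure_pmf_real[where A = "configs n"])
    (auto simp: set_pmf_gibbs pmf_gibbs sum_divide_distrib mult.commute)

lemma marg1_eq_pmf: "marg1 n nb w F x = pmf (marginals (gibbs_pmf n nb w F) x)"
  by (rule ext) (simp add: marg1_def pmf_map_eq_expectation expectation_gibbs sum.inter_filter
      of_bool_def if_distrib cong: if_cong)

lemma marg2_eq_pmf: "marg2 n nb w F x y = pmf (map_pmf (\<lambda>\<sigma>. (\<sigma> x, \<sigma> y)) (gibbs_pmf n nb w F))"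
proof (rule ext)
  fix st :: "'w \<times> 'w"
  show "marg2 n nb w F x y st = pmf (map_pmf (\<lambda>\<sigma>. (\<sigma> x, \<sigma> y)) (gibbs_pmf n nb w F)) st"
    by (simp add: marg2_def pmf_map_eq_expectation expectation_gibbs sum.inter_filter
        of_bool_def if_distrib prod_eq_iff cong: if_cong)
qed

lemma expectation_gibbs_isolated:
  assumes "x < n" and isolated: "\<And>a. a \<in> F \<Longrightarrow> x \<notin> set (nb a)"
  shows "measure_pmf.expectation (gibbs_pmf n nb w F) (\<lambda>\<sigma>. of_bool (\<sigma> x = s) * g \<sigma>)
    = measure_pmf.expectation (gibbs_pmf n nb w F) (\<lambda>\<sigma>. g (\<sigma>(x := s))) / real CARD('w)"
proof -
  let ?\<phi> = "\<lambda>\<sigma>. gweight nb w F \<sigma> * g \<sigma>"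
  have "gweight nb w F (\<sigma>(x := s)) = gweight nb w F \<sigma>" for \<sigma>
    unfolding gweight_def using isolated
    by (intro prod.cong refl arg_cong[of _ _ "w _"]) (auto intro!: map_cong)
  then have "(\<Sum>\<sigma>\<in>configs n. gweight nb w F \<sigma> * g (\<sigma>(x := s))) = (\<Sum>\<sigma>\<in>configs n. ?\<phi> (\<sigma>(x := s)))"
    by simp
  also have "\<dots> = real CARD('w) * (\<Sum>\<sigma>\<in>configs n. gweight nb w F \<sigma> * (of_bool (\<sigma> x = s) * g \<sigma>))"
    unfolding sum_configs_fun_upd[OF assms(1), of ?\<phi>]
    by (subst sum.inter_filter) (auto intro!: sum.cong)
  finally show ?thesis by (simp add: expectation_gibbs)
qed

end

lemma expectation_gibbs_tilt:
  fixes w :: "nat \<Rightarrow> 'w::finite list \<Rightarrow> real"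
  assumes "positive_on nb w F" "positive_on nb w F'"
    and "\<And>\<sigma>. \<sigma> \<in> configs n \<Longrightarrow> gweight nb w F' \<sigma> = gweight nb w F \<sigma> * r \<sigma>"
  shows "measure_pmf.expectation (gibbs_pmf n nb w F') g
    = measure_pmf.expectation (gibbs_pmf n nb w F) (\<lambda>\<sigma>. g \<sigma> * r \<sigma>)
      / measure_pmf.expectation (gibbs_pmf n nb w F) r"
  using assms(3) partition_fun_pos[OF assms(1), of n]
  by (simp add: expectation_gibbs[OF assms(1)] expectation_gibbs[OF assms(2)] partition_fun_def mult_ac)

definition normalized :: "('b::finite \<Rightarrow> real) \<Rightarrow> 'b \<Rightarrow> real" where
  "normalized f s = f s / (\<Sum>t\<in>UNIV. f t)"

lemma marg1_attach_isolated:
  fixes w :: "nat \<Rightarrow> 'w::finite list \<Rightarrow> real"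
  assumes x_less: "x < n" and isolated: "\<And>a. a \<in> F \<Longrightarrow> x \<notin> set (nb a)"
    and "finite F" "finite B" "F \<inter> B = {}" and positive: "positive_on nb w (F \<union> B)"
  shows "marg1 n nb w (F \<union> B) x
    = normalized (\<lambda>s. measure_pmf.expectation (gibbs_pmf n nb w F) (\<lambda>\<sigma>. gweight nb w B (\<sigma>(x := s))))"
proof
  fix s
  let ?g = "gweight nb w B"
  have F_positive: "positive_on nb w F" using positive by (simp add: positive_on_def)
  interpret spin_distribution "gibbs_pmf n nb w F" by (rule spin_distribution_gibbs[OF F_positive])
  let ?p = "\<lambda>s. expect (\<lambda>\<sigma>. ?g (\<sigma>(x := s)))"
  have pinned: "expect (\<lambda>\<sigma>. of_bool (\<sigma> x = t) * ?g \<sigma>) = ?p t / real CARD('w)" for t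
    by (rule expectation_gibbs_isolated[OF F_positive x_less isolated])
  have "expect ?g = expect (\<lambda>\<sigma>. \<Sum>t\<in>UNIV. of_bool (\<sigma> x = t) * ?g \<sigma>)"
    by (simp add: of_bool_def flip: sum_distrib_right)
  also have "\<dots> = (\<Sum>t\<in>UNIV. ?p t) / real CARD('w)"
    unfolding sum_divide_distrib pinned[symmetric]
    by (rule Bochner_Integration.integral_sum) (rule integrable_real)
  finally have total: "expect ?g = (\<Sum>t\<in>UNIV. ?p t) / real CARD('w)" .
  have "marg1 n nb w (F \<union> B) x s = expect (\<lambda>\<sigma>. of_bool (\<sigma> x = s) * ?g \<sigma>) / expect ?g"
    unfolding marg1_eq_pmf[OF positive] pmf_map_eq_expectation
    by (rule expectation_gibbs_tilt[OF F_positive positive]) (simp add: gweight_union assms)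
  also have "\<dots> = normalized ?p s"
    by (simp add: pinned total normalized_def)
  finally show "marg1 n nb w (F \<union> B) x s = normalized ?p s" .
qed

definition weights_bdd :: "real \<Rightarrow> (nat \<Rightarrow> nat list) \<Rightarrow> (nat \<Rightarrow> 'w list \<Rightarrow> real) \<Rightarrow> nat set \<Rightarrow> bool" where
  "weights_bdd K nb w F \<longleftrightarrow> 1 \<le> K \<and> (\<forall>a\<in>F. \<forall>\<sigma>. 1 / K \<le> w a (map \<sigma> (nb a)) \<and> w a (map \<sigma> (nb a)) \<le> K)"

lemma weights_bdd_subset: "weights_bdd K nb w F \<Longrightarrow> F' \<subseteq> F \<Longrightarrow> weights_bdd K nb w F'"
  unfolding weights_bdd_def by blast

lemma weights_bdd_positive:
  assumes "weights_bdd K nb w F"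
  shows "positive_on nb w F"
proof -
  have "0 < 1 / K" using assms by (simp add: weights_bdd_def)
  then show ?thesis using assms less_le_trans unfolding weights_bdd_def positive_on_def by blast
qed

lemma gweight_bounds:
  assumes weights: "weights_bdd K nb w D" and card_le: "card D \<le> d"
  shows "1 / K ^ d \<le> gweight nb w D \<sigma>" "gweight nb w D \<sigma> \<le> K ^ d"
proof -
  have K_ge_1: "1 \<le> K"
    and weight_bounds: "\<And>a. a \<in> D \<Longrightarrow> 1 / K \<le> w a (map \<sigma> (nb a)) \<and> w a (map \<sigma> (nb a)) \<le> K"
    using weights by (auto simp: weights_bdd_def)
  have "1 / K ^ d \<le> 1 / K ^ card D" using K_ge_1 card_le by (simp add: field_simps power_increasing)
  also have "\<dots> = (\<Prod>a\<in>D. 1 / K)" by (simp add: power_divide)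
  also have "\<dots> \<le> gweight nb w D \<sigma>" unfolding gweight_def using K_ge_1 weight_bounds
    by (intro prod_mono) auto
  finally show "1 / K ^ d \<le> gweight nb w D \<sigma>" .
  have "gweight nb w D \<sigma> \<le> (\<Prod>a\<in>D. K)"
    unfolding gweight_def using weight_bounds weights_bdd_positive[OF weights]
    by (intro prod_mono) (auto simp: positive_on_def less_imp_le)
  also have "\<dots> \<le> K ^ d" using K_ge_1 card_le by (simp add: power_increasing)
  finally show "gweight nb w D \<sigma> \<le> K ^ d" .
qed

lemma abs_gweight_le:
  assumes "weights_bdd K nb w D" "card D \<le> d"
  shows "\<bar>gweight nb w D \<sigma>\<bar> \<le> K ^ d"
  using gweight_bounds(2)[OF assms] gweight_pos[OF weights_bdd_positive[OF assms(1)]]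
  by (simp add: less_imp_le)

lemma mixing_gibbs_delete:
  fixes w :: "nat \<Rightarrow> 'w::finite list \<Rightarrow> real"
  assumes weights: "weights_bdd K nb w F" and "finite F" "D \<subseteq> F" and card_le: "card D \<le> d"
    and mixing: "mixing V (gibbs_pmf n nb w F) v \<eta>"
  shows "mixing V (gibbs_pmf n nb w (F - D)) v ((K ^ d)\<^sup>2 * \<eta>)"
proof -
  let ?r = "\<lambda>\<sigma>. 1 / gweight nb w D \<sigma>"
  have K_ge_1: "1 \<le> K" using weights by (simp add: weights_bdd_def)
  have D_weights: "weights_bdd K nb w D" and positive: "positive_on nb w F" "positive_on nb w (F - D)"
    using weights_bdd_subset[OF weights] \<open>D \<subseteq> F\<close> by (auto intro!: weights_bdd_positive[of K])
  have gweight_delete: "gweight nb w (F - D) \<sigma> = gweight nb w F \<sigma> * ?r \<sigma>" for \<sigma>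
    using gweight_union[of D "F - D" nb w \<sigma>] gweight_pos[OF weights_bdd_positive[OF D_weights], of \<sigma>]
      finite_subset[OF \<open>D \<subseteq> F\<close>] assms(2,3) by (simp add: Un_absorb1)
  interpret spin_distribution "gibbs_pmf n nb w F" by (rule spin_distribution_gibbs[OF positive(1)])
  show ?thesis
  proof (rule mixing_tilt[OF mixing])
    show "measure_pmf.expectation (gibbs_pmf n nb w (F - D)) g = expect (\<lambda>\<sigma>. g \<sigma> * ?r \<sigma>) / expect ?r" for g
      by (rule expectation_gibbs_tilt[OF positive gweight_delete])
    show "1 / K ^ d \<le> ?r \<sigma> \<and> ?r \<sigma> \<le> K ^ d" for \<sigma>
      using gweight_bounds[OF D_weights card_le, of \<sigma>]
        gweight_pos[OF weights_bdd_positive[OF D_weights], of \<sigma>] K_ge_1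
      by (auto simp: field_simps)
  qed (use K_ge_1 positive in \<open>auto simp: set_pmf_gibbs\<close>)
qed

definition tv_total :: "nat \<Rightarrow> 'w::finite fgraph \<Rightarrow> real" where
  "tv_total n G = (\<Sum>x<n. \<Sum>y<n. tv_pair n G x y)"

lemma tv_pair_nonneg [simp]: "0 \<le> tv_pair n G x y"
  by (simp add: tv_pair_def sum_nonneg)

lemma tv_total_nonneg: "0 \<le> tv_total n G"
  by (simp add: tv_total_def sum_nonneg)

lemma tv_pair_le_1:
  fixes w :: "nat \<Rightarrow> 'w::finite list \<Rightarrow> real"
  assumes "positive_on nb w {..<m}"
  shows "tv_pair n (m, nb, w) x y \<le> 1"
proof -
  define p where "p = gibbs_pmf n nb w {..<m}"
  let ?joint = "map_pmf (\<lambda>\<sigma>. (\<sigma> x, \<sigma> y)) p" and ?prod = "pair_pmf (marginals p x) (marginals p y)"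
  have "pmf ?prod st = pmf (marginals p x) (fst st) * pmf (marginals p y) (snd st)" for st
    by (cases st) (simp add: pmf_pair)
  then have "2 * tv_pair n (m, nb, w) x y = (\<Sum>st\<in>UNIV. \<bar>pmf ?joint st - pmf ?prod st\<bar>)"
    by (simp add: tv_pair_def mu1_def mu2_def marg1_eq_pmf[OF assms] marg2_eq_pmf[OF assms] p_def)
  also have "\<dots> \<le> (\<Sum>st\<in>UNIV. pmf ?joint st + pmf ?prod st)"
    by (intro sum_mono order_trans[OF abs_triangle_ineq4]) simp
  also have "\<dots> = 2"
    by (simp add: sum.distrib sum_pmf_eq_1)
  finally show ?thesis by simp
qed

lemma mixing_gibbs_of_tv_total:
  fixes w :: "nat \<Rightarrow> 'w::finite list \<Rightarrow> real"
  assumes positive: "positive_on nb w {..<m}" and tv_le: "tv_total n (m, nb, w) \<le> \<delta> * (real n)\<^sup>2"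
  defines "p \<equiv> gibbs_pmf n nb w {..<m}"
  shows "mixing {..<n} p (marginals p) (real CARD('w) * sqrt (2 * \<delta>))"
proof -
  interpret spin_distribution p unfolding p_def by (rule spin_distribution_gibbs[OF positive])
  let ?spin = "\<lambda>t y \<sigma>. of_bool (\<sigma> y = t) :: real"
  have "2 * tv_pair n (m, nb, w) x y = (\<Sum>st\<in>UNIV. \<bar>cov (?spin (fst st) x) (?spin (snd st) y)\<bar>)" for x y
    by (simp add: tv_pair_def mu1_def mu2_def marg1_eq_pmf[OF positive] marg2_eq_pmf[OF positive]
        pmf_map_eq_expectation covariance_def p_def prod_eq_iff of_bool_conj)
  then have diagonal: "\<bar>cov (?spin t x) (?spin t y)\<bar> \<le> 2 * tv_pair n (m, nb, w) x y" for t x y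
    using member_le_sum[of "(t, t)" UNIV "\<lambda>st. \<bar>cov (?spin (fst st) x) (?spin (snd st) y)\<bar>"] by simp
  have "(\<Sum>x<n. \<Sum>y<n. \<bar>cov (?spin t x) (?spin t y)\<bar>) \<le> 2 * \<delta> * (real n)\<^sup>2" for t
  proof -
    have "(\<Sum>x<n. \<Sum>y<n. \<bar>cov (?spin t x) (?spin t y)\<bar>) \<le> 2 * tv_total n (m, nb, w)"
      unfolding tv_total_def sum_distrib_left by (intro sum_mono diagonal)
    with tv_le show ?thesis by simp
  qed
  then show ?thesis by (intro mixing_of_small_covariances) simp
qed

section \<open>Belief Propagation errors\<close>

lemma normalized_prod_normalized:
  assumes "\<And>b. b \<in> B \<Longrightarrow> (\<Sum>t\<in>UNIV. p b t) \<noteq> 0"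
  shows "normalized (\<lambda>s. \<Prod>b\<in>B. normalized (p b) s) = normalized (\<lambda>s. \<Prod>b\<in>B. p b s)"
proof
  fix s
  have "(\<Prod>b\<in>B. \<Sum>t\<in>UNIV. p b t) \<noteq> 0"
    using assms by (cases "finite B") auto
  then show "normalized (\<lambda>s. \<Prod>b\<in>B. normalized (p b) s) s = normalized (\<lambda>s. \<Prod>b\<in>B. p b s) s"
    by (simp add: normalized_def prod_dividef flip: sum_divide_distrib)
qed

lemma sum_abs_normalized_diff_le:
  fixes f g :: "'b::finite \<Rightarrow> real"
  assumes c_bounds: "0 < c" "\<And>s. c \<le> f s" and g_pos: "\<And>s. 0 < g s"
  shows "(\<Sum>s\<in>UNIV. \<bar>normalized f s - normalized g s\<bar>) \<le> 2 / c * (\<Sum>s\<in>UNIV. \<bar>f s - g s\<bar>)"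
proof -
  define a b where "a = (\<Sum>t\<in>UNIV. f t)" and "b = (\<Sum>t\<in>UNIV. g t)"
  let ?\<Delta> = "\<Sum>s\<in>UNIV. \<bar>f s - g s\<bar>"
  have b_pos: "0 < b"
    unfolding b_def using g_pos by (intro sum_pos) auto
  have "c \<le> f undefined" by (rule c_bounds)
  also have "\<dots> \<le> a"
    unfolding a_def using c_bounds
    by (intro member_le_sum) (auto intro: order_trans[of 0 c] less_imp_le)
  finally have a_bounds: "c \<le> a" "0 < a" using c_bounds(1) by auto
  have sums_diff_le: "\<bar>b - a\<bar> \<le> ?\<Delta>"
    using sum_abs[of "\<lambda>s. f s - g s" UNIV]
    by (simp add: a_def b_def sum_subtractf abs_minus_commute)
  have "\<bar>f s / a - g s / b\<bar> \<le> \<bar>f s - g s\<bar> / a + g s * (?\<Delta> / (a * b))" for s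
  proof -
    have "f s / a - g s / b = (f s - g s) / a + g s * ((b - a) / (a * b))"
      using a_bounds b_pos by (simp add: field_simps)
    also have "\<bar>\<dots>\<bar> \<le> \<bar>f s - g s\<bar> / a + g s * (\<bar>b - a\<bar> / (a * b))"
      using a_bounds b_pos g_pos[of s]
      by (intro order_trans[OF abs_triangle_ineq]) (simp add: abs_mult)
    also have "\<dots> \<le> \<bar>f s - g s\<bar> / a + g s * (?\<Delta> / (a * b))"
      using a_bounds b_pos g_pos[of s]
      by (intro add_left_mono mult_left_mono divide_right_mono sums_diff_le) auto
    finally show ?thesis .
  qed
  then have "(\<Sum>s\<in>UNIV. \<bar>normalized f s - normalized g s\<bar>)
    \<le> (\<Sum>s\<in>UNIV. \<bar>f s - g s\<bar> / a + g s * (?\<Delta> / (a * b)))"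
    unfolding normalized_def a_def[symmetric] b_def[symmetric] by (rule sum_mono)
  also have "\<dots> = ?\<Delta> / a + b * (?\<Delta> / (a * b))"
    by (simp add: sum.distrib b_def flip: sum_divide_distrib sum_distrib_right)
  also have "\<dots> = 2 / a * ?\<Delta>" using b_pos by simp
  also have "\<dots> \<le> 2 / c * ?\<Delta>"
    using a_bounds c_bounds by (intro mult_right_mono divide_left_mono) (auto intro: sum_nonneg)
  finally show ?thesis .
qed

definition variable_update ::
    "nat \<Rightarrow> nat \<Rightarrow> (nat \<Rightarrow> nat list) \<Rightarrow> (nat \<Rightarrow> 'w::finite list \<Rightarrow> real) \<Rightarrow> nat \<Rightarrow> nat \<Rightarrow> 'w \<Rightarrow> real" where
  "variable_update n m nb w x a = normalized (\<lambda>s. \<Prod>b\<in>var_nbhd m nb x - {a}. msg_av n (m, nb, w) b x s)"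

definition factor_update ::
    "nat \<Rightarrow> nat \<Rightarrow> (nat \<Rightarrow> nat list) \<Rightarrow> (nat \<Rightarrow> 'w::finite list \<Rightarrow> real) \<Rightarrow> nat \<Rightarrow> nat \<Rightarrow> 'w \<Rightarrow> real" where
  "factor_update n m nb w a x = normalized (\<lambda>s. \<Sum>\<tau>\<in>PiE (set (nb a) - {x}) (\<lambda>_. UNIV).
     w a (map (\<tau>(x := s)) (nb a)) * (\<Prod>y\<in>set (nb a) - {x}. msg_va n (m, nb, w) y a (\<tau> y)))"

lemma factor_update_eq:
  fixes w :: "nat \<Rightarrow> 'w::finite list \<Rightarrow> real"
  assumes "x \<in> set (nb a)"
  shows "factor_update n m nb w a x s
    = (\<Sum>\<tau>\<in>{\<tau>\<in>PiE (set (nb a)) (\<lambda>_. UNIV). \<tau> x = s}.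
         w a (map \<tau> (nb a)) * (\<Prod>y\<in>set (nb a) - {x}. msg_va n (m, nb, w) y a (\<tau> y)))
      / (\<Sum>\<tau>\<in>PiE (set (nb a)) (\<lambda>_. UNIV).
         w a (map \<tau> (nb a)) * (\<Prod>y\<in>set (nb a) - {x}. msg_va n (m, nb, w) y a (\<tau> y)))"
proof -
  let ?Y = "set (nb a) - {x}"
  let ?\<phi> = "\<lambda>\<tau>. w a (map \<tau> (nb a)) * (\<Prod>y\<in>?Y. msg_va n (m, nb, w) y a (\<tau> y))"
  have set_nb: "set (nb a) = insert x ?Y" using assms by auto
  have prod_upd: "(\<Prod>y\<in>?Y. msg_va n (m, nb, w) y a ((\<tau>(x := s)) y))
      = (\<Prod>y\<in>?Y. msg_va n (m, nb, w) y a (\<tau> y))"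
    for \<tau> s by (rule prod.cong) auto
  have sum_fixed: "(\<Sum>\<tau>\<in>{\<tau>\<in>PiE (set (nb a)) (\<lambda>_. UNIV). \<tau> x = s}. ?\<phi> \<tau>)
    = (\<Sum>\<tau>\<in>PiE ?Y (\<lambda>_. UNIV). ?\<phi> (\<tau>(x := s)))" for s
    using sum_PiE_fixed_coordinate[where z = x and Y = ?Y and t = s and \<phi> = ?\<phi>] set_nb by simp
  have "(\<Sum>\<tau>\<in>PiE (set (nb a)) (\<lambda>_. UNIV). ?\<phi> \<tau>)
    = (\<Sum>t\<in>UNIV. \<Sum>\<tau>\<in>PiE ?Y (\<lambda>_. UNIV). ?\<phi> (\<tau>(x := t)))"
    using sum_PiE_insert[of ?Y x ?\<phi>] set_nb by simp
  then show ?thesis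
    unfolding factor_update_def normalized_def sum_fixed prod_upd by simp
qed

lemma bp_error_eq:
  "bp_error n (m, nb, w) = (\<Sum>x<n. \<Sum>a\<in>var_nbhd m nb x.
     (\<Sum>s\<in>UNIV. \<bar>msg_va n (m, nb, w) x a s - variable_update n m nb w x a s\<bar>)
     + (\<Sum>s\<in>UNIV. \<bar>msg_av n (m, nb, w) a x s - factor_update n m nb w a x s\<bar>))"
  unfolding bp_error_def prod.case
  by (intro sum.cong refl)
    (simp add: sum.distrib variable_update_def normalized_def factor_update_eq var_nbhd_def)

abbreviation cavity_pmf ::
    "nat \<Rightarrow> nat \<Rightarrow> (nat \<Rightarrow> nat list) \<Rightarrow> (nat \<Rightarrow> 'w list \<Rightarrow> real) \<Rightarrow> nat \<Rightarrow> (nat \<Rightarrow> 'w) pmf" where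
  "cavity_pmf n m nb w x \<equiv> gibbs_pmf n nb w ({..<m} - var_nbhd m nb x)"

definition pinned_deviation ::
    "nat \<Rightarrow> nat \<Rightarrow> (nat \<Rightarrow> nat list) \<Rightarrow> (nat \<Rightarrow> 'w::finite list \<Rightarrow> real)
      \<Rightarrow> nat \<Rightarrow> nat \<Rightarrow> 'w \<Rightarrow> nat set \<Rightarrow> real" where
  "pinned_deviation n m nb w x a s D = product_deviation (cavity_pmf n m nb w x)
     (marginals (gibbs_pmf n nb w ({..<m} - {a}))) (\<lambda>\<sigma>. gweight nb w D (\<sigma>(x := s))) (set (nb a) - {x})"

text \<open>The summand \<open>D = {}\<close> controls the constraint-to-variable message; the other ones control the
  correlations between the constraint nodes at \<open>x\<close>, which enter the variable-to-constraint messages.\<close>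

definition edge_error ::
    "nat \<Rightarrow> nat \<Rightarrow> (nat \<Rightarrow> nat list) \<Rightarrow> (nat \<Rightarrow> 'w::finite list \<Rightarrow> real) \<Rightarrow> nat \<Rightarrow> nat \<Rightarrow> real" where
  "edge_error n m nb w x a =
     (\<Sum>s\<in>UNIV. \<Sum>D\<in>Pow (var_nbhd m nb x - {a}). pinned_deviation n m nb w x a s D)"

lemma pinned_deviation_nonneg [simp]: "0 \<le> pinned_deviation n m nb w x a s D"
  by (simp add: pinned_deviation_def)

lemma edge_error_nonneg [simp]: "0 \<le> edge_error n m nb w x a"
  by (simp add: edge_error_def sum_nonneg)

lemma finite_var_nbhd [simp]: "finite (var_nbhd m nb x)"
  by (simp add: var_nbhd_def)

lemma var_nbhd_subset: "var_nbhd m nb x \<subseteq> {..<m}"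
  by (auto simp: var_nbhd_def)

definition bp_const :: "nat \<Rightarrow> real \<Rightarrow> real" where
  "bp_const d K = 2 * K ^ (2 * d + 1) * (1 + 2 ^ d * K ^ d) * real d + 2 * K\<^sup>2"

locale bounded_factor_graph =
  fixes n m d :: nat and nb :: "nat \<Rightarrow> nat list" and w :: "nat \<Rightarrow> 'w::finite list \<Rightarrow> real" and K :: real
  assumes weights_bdd: "weights_bdd K nb w {..<m}"
    and degree_le: "\<And>x. x < n \<Longrightarrow> card (var_nbhd m nb x) \<le> d"
begin

abbreviation N :: "nat \<Rightarrow> nat set" where
  "N \<equiv> var_nbhd m nb"

abbreviation cavity :: "nat \<Rightarrow> (nat \<Rightarrow> 'w) pmf" where
  "cavity \<equiv> cavity_pmf n m nb w"

abbreviation pinned :: "nat \<Rightarrow> 'w \<Rightarrow> nat set \<Rightarrow> (nat \<Rightarrow> 'w) \<Rightarrow> real" where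
  "pinned x s D \<sigma> \<equiv> gweight nb w D (\<sigma>(x := s))"

abbreviation pinned_mean :: "nat \<Rightarrow> 'w \<Rightarrow> nat set \<Rightarrow> real" where
  "pinned_mean x s D \<equiv> measure_pmf.expectation (cavity x) (pinned x s D)"

lemma K_ge_1: "1 \<le> K"
  using weights_bdd by (simp add: weights_bdd_def)

lemma positive_subset: "F \<subseteq> {..<m} \<Longrightarrow> positive_on nb w F"
  by (rule weights_bdd_positive) (rule weights_bdd_subset[OF weights_bdd])

lemma spin_distribution_cavity: "spin_distribution (cavity x)"
  by (intro spin_distribution_gibbs positive_subset) auto

lemma pinned_bounds:
  assumes "D \<subseteq> N x" "card D \<le> e"
  shows "1 / K ^ e \<le> gweight nb w D \<sigma>" "\<bar>gweight nb w D \<sigma>\<bar> \<le> K ^ e"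
  using gweight_bounds(1) abs_gweight_le weights_bdd_subset[OF weights_bdd] assms var_nbhd_subset
  by (meson order_trans)+

lemma card_subset_N_le: "x < n \<Longrightarrow> D \<subseteq> N x \<Longrightarrow> card D \<le> d"
  using degree_le card_mono[of "N x" D] by (meson finite_var_nbhd order_trans)

lemma marg1_attach_cavity:
  assumes "x < n" "B \<subseteq> N x"
  shows "marg1 n nb w (({..<m} - N x) \<union> B) x = normalized (\<lambda>s. pinned_mean x s B)"
  using assms finite_subset[OF assms(2)] var_nbhd_subset[of m nb x]
  by (intro marg1_attach_isolated positive_subset) (auto simp: var_nbhd_def)

lemma msg_va_eq:
  assumes "x < n" "a \<in> N x"
  shows "msg_va n (m, nb, w) x a = normalized (\<lambda>s. pinned_mean x s (N x - {a}))"
proof -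
  have "{..<m} - {a} = ({..<m} - N x) \<union> (N x - {a})"
    using assms var_nbhd_subset[of m nb x] by auto
  then show ?thesis
    using marg1_attach_cavity[of x "N x - {a}"] assms(1) by (simp add: msg_va_def fun_eq_iff)
qed

lemma msg_av_eq:
  assumes "x < n" "a \<in> N x"
  shows "msg_av n (m, nb, w) a x = normalized (\<lambda>s. pinned_mean x s {a})"
proof -
  have "{..<m} - (N x - {a}) = ({..<m} - N x) \<union> {a}"
    using assms var_nbhd_subset[of m nb x] by auto
  then show ?thesis
    using marg1_attach_cavity[of x "{a}"] assms
    by (simp add: msg_av_def fun_eq_iff del: gweight_singleton)
qed

lemma pinned_mean_ge:
  assumes "D \<subseteq> N x" "card D \<le> e"
  shows "1 / K ^ e \<le> pinned_mean x s D"
proof -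
  interpret spin_distribution "cavity x" by (rule spin_distribution_cavity)
  show ?thesis by (rule expect_ge) (rule pinned_bounds(1)[OF assms])
qed

lemma pinned_mean_pos:
  assumes "b \<in> N x"
  shows "0 < pinned_mean x s {b}"
proof -
  have "0 < 1 / K" using K_ge_1 by simp
  also have "\<dots> \<le> pinned_mean x s {b}"
    using pinned_mean_ge[of "{b}" x 1 s] assms by simp
  finally show ?thesis .
qed

lemma pinned_local:
  "pinned x s {a} (restrict \<sigma> (set (nb a) - {x})) = pinned x s {a} \<sigma>"
  by (auto intro!: arg_cong[of _ _ "w a"])

lemma covariance_pinned_le:
  assumes x_less: "x < n" and b_mem: "b \<in> N x" and D_sub: "D \<subseteq> N x"
  shows "\<bar>covariance (cavity x) (pinned x s D) (pinned x s {b})\<bar>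
    \<le> K * (pinned_deviation n m nb w x b s D + K ^ d * pinned_deviation n m nb w x b s {})"
proof -
  interpret spin_distribution "cavity x" by (rule spin_distribution_cavity)
  have "\<bar>cov (pinned x s D) (pinned x s {b})\<bar>
    \<le> K * (product_deviation (cavity x) v (pinned x s D) (set (nb b) - {x})
        + K ^ d * product_deviation (cavity x) v (\<lambda>_. 1) (set (nb b) - {x}))" for v
  proof (rule covariance_local_le)
    show "\<bar>pinned x s {b} \<sigma>\<bar> \<le> K" for \<sigma>
      using pinned_bounds(2)[of "{b}" x 1] b_mem by simp
    show "\<bar>pinned x s D \<sigma>\<bar> \<le> K ^ d" for \<sigma>
      by (rule pinned_bounds(2)[OF D_sub card_subset_N_le[OF x_less D_sub]])
  qed (simp_all only: pinned_local, simp)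
  then show ?thesis by (simp add: pinned_deviation_def gweight_def)
qed

lemma sum_covariance_pinned_le:
  assumes x_less: "x < n" and b_mem: "b \<in> N x" and B_sub: "B \<subseteq> N x"
  shows "(\<Sum>D\<in>Pow (B - {b}). \<bar>covariance (cavity x) (pinned x s D) (pinned x s {b})\<bar>)
    \<le> K * (1 + 2 ^ d * K ^ d) * (\<Sum>D\<in>Pow (N x - {b}). pinned_deviation n m nb w x b s D)"
proof -
  let ?dev = "pinned_deviation n m nb w x b s" and ?P = "Pow (N x - {b})"
  have "(\<Sum>D\<in>Pow (B - {b}). \<bar>covariance (cavity x) (pinned x s D) (pinned x s {b})\<bar>)
    \<le> (\<Sum>D\<in>?P. \<bar>covariance (cavity x) (pinned x s D) (pinned x s {b})\<bar>)"
    using B_sub by (intro sum_mono2) auto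
  also have "\<dots> \<le> (\<Sum>D\<in>?P. K * (?dev D + K ^ d * ?dev {}))"
    using x_less b_mem by (intro sum_mono covariance_pinned_le) auto
  also have "\<dots> = K * ((\<Sum>D\<in>?P. ?dev D) + real (card ?P) * (K ^ d * ?dev {}))"
    by (simp add: sum.distrib flip: sum_distrib_left)
  also have "\<dots> \<le> K * ((\<Sum>D\<in>?P. ?dev D) + 2 ^ d * (K ^ d * (\<Sum>D\<in>?P. ?dev D)))"
  proof (intro mult_left_mono add_left_mono mult_mono)
    show "real (card ?P) \<le> 2 ^ d"
      using card_subset_N_le[OF x_less, of "N x - {b}"] by (simp add: card_Pow power_increasing)
    show "?dev {} \<le> (\<Sum>D\<in>?P. ?dev D)"
      by (intro member_le_sum) auto
  qed (use K_ge_1 in auto)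
  finally show ?thesis by (simp add: algebra_simps)
qed

lemma variable_update_eq:
  assumes "x < n"
  shows "variable_update n m nb w x a = normalized (\<lambda>s. \<Prod>b\<in>N x - {a}. pinned_mean x s {b})"
proof -
  have "(\<Sum>t\<in>UNIV. pinned_mean x t {b}) \<noteq> 0" if "b \<in> N x - {a}" for b
    using that pinned_mean_pos[of b x] by (intro less_imp_neq[THEN not_sym] sum_pos) auto
  then have "normalized (\<lambda>s. \<Prod>b\<in>N x - {a}. normalized (\<lambda>s. pinned_mean x s {b}) s)
    = normalized (\<lambda>s. \<Prod>b\<in>N x - {a}. pinned_mean x s {b})"
    by (rule normalized_prod_normalized)
  moreover have "(\<Prod>b\<in>N x - {a}. msg_av n (m, nb, w) b x s)
    = (\<Prod>b\<in>N x - {a}. normalized (\<lambda>s. pinned_mean x s {b}) s)" for s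
    using assms by (intro prod.cong) (auto simp: msg_av_eq simp del: gweight_singleton)
  ultimately show ?thesis by (simp add: variable_update_def)
qed

lemma pinned_factorization:
  assumes x_less: "x < n" and B_sub: "B \<subseteq> N x"
  shows "\<bar>pinned_mean x s B - (\<Prod>b\<in>B. pinned_mean x s {b})\<bar>
    \<le> K ^ d * (K * (1 + 2 ^ d * K ^ d)
        * (\<Sum>b\<in>N x. \<Sum>D\<in>Pow (N x - {b}). pinned_deviation n m nb w x b s D))"
proof -
  interpret spin_distribution "cavity x" by (rule spin_distribution_cavity)
  let ?L = "K * (1 + 2 ^ d * K ^ d)"
  let ?devs = "\<lambda>b. \<Sum>D\<in>Pow (N x - {b}). pinned_deviation n m nb w x b s D"
  have "\<bar>pinned x s {b} \<sigma>\<bar> \<le> K" if "b \<in> B" for b \<sigma>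
    using pinned_bounds(2)[of "{b}" x 1] that B_sub by auto
  then have "\<bar>pinned_mean x s B - (\<Prod>b\<in>B. pinned_mean x s {b})\<bar>
    \<le> K ^ card B * (\<Sum>b\<in>B. \<Sum>D\<in>Pow (B - {b}). \<bar>cov (pinned x s D) (pinned x s {b})\<bar>)"
    using expect_prod_approx[OF K_ge_1 finite_subset[OF B_sub finite_var_nbhd], of "\<lambda>b. pinned x s {b}"]
    by (simp add: gweight_def)
  also have "\<dots> \<le> K ^ d * (\<Sum>b\<in>B. ?L * ?devs b)"
  proof (rule mult_mono)
    show "K ^ card B \<le> K ^ d"
      by (rule power_increasing[OF card_subset_N_le[OF x_less B_sub] K_ge_1])
    show "(\<Sum>b\<in>B. \<Sum>D\<in>Pow (B - {b}). \<bar>cov (pinned x s D) (pinned x s {b})\<bar>) \<le> (\<Sum>b\<in>B. ?L * ?devs b)"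
      using B_sub by (intro sum_mono sum_covariance_pinned_le[OF x_less _ B_sub]) auto
  qed (use K_ge_1 in \<open>auto intro!: sum_nonneg\<close>)
  also have "\<dots> \<le> K ^ d * (?L * (\<Sum>b\<in>N x. ?devs b))"
    unfolding sum_distrib_left[symmetric]
    using K_ge_1 B_sub by (intro mult_left_mono sum_mono2) (auto intro!: sum_nonneg)
  finally show ?thesis .
qed

lemma variable_message_error_le:
  assumes x_less: "x < n" and a_mem: "a \<in> N x"
  shows "(\<Sum>s\<in>UNIV. \<bar>msg_va n (m, nb, w) x a s - variable_update n m nb w x a s\<bar>)
    \<le> 2 * K ^ (2 * d + 1) * (1 + 2 ^ d * K ^ d) * (\<Sum>b\<in>N x. edge_error n m nb w x b)"
proof -
  let ?B = "N x - {a}"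
  let ?L = "K * (1 + 2 ^ d * K ^ d)"
  let ?devs = "\<lambda>s b. \<Sum>D\<in>Pow (N x - {b}). pinned_deviation n m nb w x b s D"
  have "(\<Sum>s\<in>UNIV. \<bar>msg_va n (m, nb, w) x a s - variable_update n m nb w x a s\<bar>)
    \<le> 2 / (1 / K ^ d) * (\<Sum>s\<in>UNIV. \<bar>pinned_mean x s ?B - (\<Prod>b\<in>?B. pinned_mean x s {b})\<bar>)"
    unfolding msg_va_eq[OF x_less a_mem] variable_update_eq[OF x_less]
    using K_ge_1 card_subset_N_le[OF x_less, of ?B]
    by (intro sum_abs_normalized_diff_le pinned_mean_ge prod_pos pinned_mean_pos) auto
  also have "\<dots> = 2 * K ^ d * (\<Sum>s\<in>UNIV. \<bar>pinned_mean x s ?B - (\<Prod>b\<in>?B. pinned_mean x s {b})\<bar>)"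
    by simp
  also have "\<dots> \<le> 2 * K ^ d * (\<Sum>s\<in>UNIV. K ^ d * (?L * (\<Sum>b\<in>N x. ?devs s b)))"
    using K_ge_1 by (intro mult_left_mono sum_mono pinned_factorization x_less) auto
  also have "\<dots> = 2 * K ^ (2 * d + 1) * (1 + 2 ^ d * K ^ d) * (\<Sum>s\<in>UNIV. \<Sum>b\<in>N x. ?devs s b)"
  proof -
    have "K ^ (2 * d + 1) = K ^ d * K ^ d * K" by (simp add: power_add mult_2)
    then show ?thesis by (simp only: sum_distrib_left[symmetric] mult_ac)
  qed
  also have "(\<Sum>s\<in>UNIV. \<Sum>b\<in>N x. ?devs s b) = (\<Sum>b\<in>N x. edge_error n m nb w x b)"
    unfolding edge_error_def by (rule sum.swap)
  finally show ?thesis .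
qed

lemma factor_message_error_le:
  assumes x_less: "x < n" and a_mem: "a \<in> N x"
  shows "(\<Sum>s\<in>UNIV. \<bar>msg_av n (m, nb, w) a x s - factor_update n m nb w a x s\<bar>)
    \<le> 2 * K\<^sup>2 * edge_error n m nb w x a"
proof -
  interpret spin_distribution "cavity x" by (rule spin_distribution_cavity)
  let ?Y = "set (nb a) - {x}" and ?v = "marginals (gibbs_pmf n nb w ({..<m} - {a}))"
  define R where "R s = (\<Sum>\<tau>\<in>PiE ?Y (\<lambda>_. UNIV). pinned x s {a} \<tau> * (\<Prod>y\<in>?Y. pmf (?v y) (\<tau> y)))" for s
  have pinned_weight_bounds: "1 / K \<le> pinned x s {a} \<tau>" "\<bar>pinned x s {a} \<tau>\<bar> \<le> K" for s \<tau>
    using pinned_bounds[of "{a}" x 1] a_mem by simp_all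
  have "0 < 1 / K" using K_ge_1 by simp
  also have "1 / K \<le> R s" for s
  proof -
    have "1 / K = (\<Sum>\<tau>\<in>PiE ?Y (\<lambda>_. UNIV). 1 / K * (\<Prod>y\<in>?Y. pmf (?v y) (\<tau> y)))"
      using sum_prod_pmf_PiE[of ?Y ?v] unfolding sum_distrib_left[symmetric] by simp
    also have "\<dots> \<le> R s"
      unfolding R_def by (intro sum_mono mult_right_mono pinned_weight_bounds prod_nonneg) simp
    finally show ?thesis .
  qed
  finally have R_pos: "0 < R s" for s .
  have approx: "\<bar>pinned_mean x s {a} - R s\<bar> \<le> K * pinned_deviation n m nb w x a s {}" for s
    using expect_local_approx[of ?Y "pinned x s {a}" K "\<lambda>_. 1" ?v,
        OF _ pinned_local pinned_weight_bounds(2)]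
    by (simp add: R_def pinned_deviation_def gweight_def)
  have "factor_update n m nb w a x = normalized R"
    by (simp add: factor_update_def R_def[abs_def] msg_va_def marg1_eq_pmf positive_subset)
  then have "(\<Sum>s\<in>UNIV. \<bar>msg_av n (m, nb, w) a x s - factor_update n m nb w a x s\<bar>)
    \<le> 2 / (1 / K) * (\<Sum>s\<in>UNIV. \<bar>pinned_mean x s {a} - R s\<bar>)"
    unfolding msg_av_eq[OF x_less a_mem]
    using K_ge_1 R_pos pinned_mean_ge[of "{a}" x 1] a_mem
    by (simp only:, intro sum_abs_normalized_diff_le) auto
  also have "\<dots> \<le> 2 / (1 / K) * (\<Sum>s\<in>UNIV. K * (\<Sum>D\<in>Pow (N x - {a}). pinned_deviation n m nb w x a s D))"
  proof (intro mult_left_mono sum_mono order_trans[OF approx])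
    show "pinned_deviation n m nb w x a s {}
      \<le> (\<Sum>D\<in>Pow (N x - {a}). pinned_deviation n m nb w x a s D)" for s
      by (intro member_le_sum) auto
  qed (use K_ge_1 in auto)
  also have "\<dots> = 2 * K\<^sup>2 * edge_error n m nb w x a"
    by (simp add: edge_error_def power2_eq_square flip: sum_distrib_left)
  finally show ?thesis .
qed

lemma bp_error_le: "bp_error n (m, nb, w) \<le> bp_const d K * (\<Sum>x<n. \<Sum>a\<in>N x. edge_error n m nb w x a)"
proof -
  define L where "L = 2 * K ^ (2 * d + 1) * (1 + 2 ^ d * K ^ d)"
  let ?e = "edge_error n m nb w"
  have "0 \<le> L" using K_ge_1 by (simp add: L_def)
  have "bp_error n (m, nb, w) \<le> (\<Sum>x<n. \<Sum>a\<in>N x. L * (\<Sum>b\<in>N x. ?e x b) + 2 * K\<^sup>2 * ?e x a)"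
    unfolding bp_error_eq L_def
    by (intro sum_mono add_mono variable_message_error_le factor_message_error_le) auto
  also have "\<dots> = (\<Sum>x<n. (L * real (card (N x)) + 2 * K\<^sup>2) * (\<Sum>a\<in>N x. ?e x a))"
    by (intro sum.cong refl) (simp add: sum.distrib algebra_simps flip: sum_distrib_left)
  also have "\<dots> \<le> (\<Sum>x<n. bp_const d K * (\<Sum>a\<in>N x. ?e x a))"
    unfolding bp_const_def L_def[symmetric] using degree_le \<open>0 \<le> L\<close>
    by (intro sum_mono mult_right_mono add_right_mono mult_left_mono) (auto intro!: sum_nonneg)
  finally show ?thesis by (simp add: sum_distrib_left)
qed

end

section \<open>Resampling one neighbour tuple\<close>

lemma var_nbhd_resample:
  assumes "a < m" "x \<in> set ys"
  shows "var_nbhd m (nb(a := ys)) x - {a} = var_nbhd m nb x - {a}"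
    and "{..<m} - var_nbhd m (nb(a := ys)) x = {..<m} - {a} - (var_nbhd m nb x - {a})"
  using assms by (auto simp: var_nbhd_def)

definition resampled_deviation ::
    "nat \<Rightarrow> nat \<Rightarrow> (nat \<Rightarrow> nat list) \<Rightarrow> (nat \<Rightarrow> 'w::finite list \<Rightarrow> real)
      \<Rightarrow> nat \<Rightarrow> nat \<Rightarrow> 'w \<Rightarrow> nat set \<Rightarrow> nat set \<Rightarrow> real" where
  "resampled_deviation n m nb w a x s D Y =
     product_deviation (gibbs_pmf n nb w ({..<m} - {a} - (var_nbhd m nb x - {a})))
       (marginals (gibbs_pmf n nb w ({..<m} - {a}))) (\<lambda>\<sigma>. gweight nb w D (\<sigma>(x := s))) Y"

lemma pinned_deviation_resample:
  assumes "a < m" "x \<in> set ys" "D \<subseteq> var_nbhd m nb x - {a}"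
  shows "pinned_deviation n m (nb(a := ys)) w x a s D
    = resampled_deviation n m nb w a x s D (set ys - {x})"
proof -
  have "a \<notin> D" using assms(3) by auto
  then show ?thesis
    unfolding pinned_deviation_def resampled_deviation_def var_nbhd_resample(2)[OF assms(1,2)]
    by (simp add: gibbs_pmf_resample gweight_resample)
qed

definition tuple_const :: "real \<Rightarrow> nat \<Rightarrow> nat \<Rightarrow> real \<Rightarrow> real" where
  "tuple_const q d k K = q * 2 ^ d * (K ^ d * ((K ^ d)\<^sup>2 * 2)) * (q + 2) ^ k"

lemma tuple_const_nonneg: "0 \<le> q \<Longrightarrow> 0 \<le> K \<Longrightarrow> 0 \<le> tuple_const q d k K"
  by (simp add: tuple_const_def)

context bounded_factor_graph
begin

lemma sum_resampled_deviation_le: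
  assumes x_less: "x < n" and D_sub: "D \<subseteq> N x - {a}"
    and mixing: "mixing {..<n} (gibbs_pmf n nb w ({..<m} - {a})) v \<eta>" and \<eta>_nonneg: "0 \<le> \<eta>"
  shows "(\<Sum>zs\<in>tuples {..<n} l. resampled_deviation n m nb w a x s D (set zs - {x}))
    \<le> K ^ d * ((K ^ d)\<^sup>2 * (2 * \<eta>)) * (real CARD('w) + 2) ^ l * real n ^ l"
proof -
  let ?F = "{..<m} - {a}" and ?v = "marginals (gibbs_pmf n nb w ({..<m} - {a}))"
  interpret full: spin_distribution "gibbs_pmf n nb w ?F"
    by (intro spin_distribution_gibbs positive_subset) auto
  interpret spin_distribution "gibbs_pmf n nb w (?F - (N x - {a}))"
    by (intro spin_distribution_gibbs positive_subset) auto
  have "mixing {..<n} (gibbs_pmf n nb w (?F - (N x - {a}))) ?v ((K ^ d)\<^sup>2 * (2 * \<eta>))"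
    using card_subset_N_le[OF x_less, of "N x - {a}"] var_nbhd_subset[of m nb x]
    by (intro mixing_gibbs_delete weights_bdd_subset[OF weights_bdd] full.mixing_marginals[OF mixing])
      auto
  moreover have "\<bar>pinned x s D \<sigma>\<bar> \<le> K ^ d" for \<sigma>
    using D_sub by (intro pinned_bounds(2)[of D x] card_subset_N_le[OF x_less]) auto
  ultimately show ?thesis
    using sum_product_deviation_tuples_le[of "{..<n}" ?v _ "pinned x s D" "K ^ d"] \<eta>_nonneg K_ge_1
    by (simp add: resampled_deviation_def)
qed

definition resampled_error :: "nat \<Rightarrow> nat \<Rightarrow> nat set \<Rightarrow> real" where
  "resampled_error a x Y =
     (\<Sum>s\<in>UNIV. \<Sum>D\<in>Pow (N x - {a}). resampled_deviation n m nb w a x s D Y)"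

lemma resampled_error_nonneg: "0 \<le> resampled_error a x Y"
  by (simp add: resampled_error_def resampled_deviation_def sum_nonneg)

lemma edge_error_resample:
  assumes "a < m" "x \<in> set ys"
  shows "edge_error n m (nb(a := ys)) w x a = resampled_error a x (set ys - {x})"
  unfolding edge_error_def resampled_error_def var_nbhd_resample(1)[OF assms]
  by (intro sum.cong refl) (use assms in \<open>auto simp: pinned_deviation_resample\<close>)

lemma sum_resampled_error_le:
  assumes x_less: "x < n" and mixing: "mixing {..<n} (gibbs_pmf n nb w ({..<m} - {a})) v \<eta>"
    and \<eta>_nonneg: "0 \<le> \<eta>"
  shows "(\<Sum>zs\<in>tuples {..<n} l. resampled_error a x (set zs - {x}))
    \<le> real CARD('w) * 2 ^ d * (K ^ d * ((K ^ d)\<^sup>2 * (2 * \<eta>)) * (real CARD('w) + 2) ^ l * real n ^ l)"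
proof -
  let ?P = "Pow (N x - {a})"
  define b where "b = K ^ d * ((K ^ d)\<^sup>2 * (2 * \<eta>)) * (real CARD('w) + 2) ^ l * real n ^ l"
  have "0 \<le> b" using K_ge_1 \<eta>_nonneg by (simp add: b_def)
  have "(\<Sum>zs\<in>tuples {..<n} l. resampled_error a x (set zs - {x}))
    = (\<Sum>s\<in>UNIV. \<Sum>D\<in>?P. \<Sum>zs\<in>tuples {..<n} l. resampled_deviation n m nb w a x s D (set zs - {x}))"
    unfolding resampled_error_def sum.swap[of _ UNIV "tuples {..<n} l"]
      sum.swap[of _ ?P "tuples {..<n} l"] ..
  also have "\<dots> \<le> (\<Sum>s\<in>(UNIV :: 'w set). \<Sum>D\<in>?P. b)"
    unfolding b_def by (intro sum_mono sum_resampled_deviation_le[OF x_less _ mixing \<eta>_nonneg]) auto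
  also have "\<dots> = real CARD('w) * (2 ^ card (N x - {a}) * b)"
    by (simp add: card_Pow)
  also have "\<dots> \<le> real CARD('w) * (2 ^ d * b)"
    using card_subset_N_le[OF x_less, of "N x - {a}"] \<open>0 \<le> b\<close>
    by (intro mult_left_mono mult_right_mono power_increasing) auto
  finally show ?thesis by (simp add: b_def)
qed

lemma sum_edge_error_resample_le:
  assumes a_less: "a < m" and mixing: "mixing {..<n} (gibbs_pmf n nb w ({..<m} - {a})) v \<eta>"
    and \<eta>_nonneg: "0 \<le> \<eta>" and l_le: "l \<le> k"
  shows "(\<Sum>ys\<in>tuples {..<n} l. \<Sum>x\<in>set ys. edge_error n m (nb(a := ys)) w x a)
    \<le> real l * (tuple_const (real CARD('w)) d k K * \<eta> * real n ^ l)"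
proof (cases l)
  case (Suc l')
  let ?q = "real CARD('w)" and ?c = "K ^ d * ((K ^ d)\<^sup>2 * (2 * \<eta>))"
  have "(\<Sum>ys\<in>tuples {..<n} l. \<Sum>x\<in>set ys. edge_error n m (nb(a := ys)) w x a)
    = (\<Sum>ys\<in>tuples {..<n} (Suc l'). \<Sum>x\<in>set ys. resampled_error a x (set ys - {x}))"
    by (simp add: Suc edge_error_resample[OF a_less])
  also have "\<dots> \<le> real (Suc l') * (\<Sum>x<n. \<Sum>zs\<in>tuples {..<n} l'. resampled_error a x (set zs - {x}))"
    by (rule sum_tuples_members_le) (rule resampled_error_nonneg)
  also have "\<dots> \<le> real (Suc l') * (\<Sum>x<n. ?q * 2 ^ d * (?c * (?q + 2) ^ l' * real n ^ l'))"
    by (intro mult_left_mono sum_mono sum_resampled_error_le[OF _ mixing \<eta>_nonneg]) auto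
  also have "\<dots> = real l * ((?q + 2) ^ l' * (?q * 2 ^ d * ?c * real n ^ l))"
    by (simp add: Suc)
  also have "\<dots> \<le> real l * ((?q + 2) ^ k * (?q * 2 ^ d * ?c * real n ^ l))"
    using l_le Suc K_ge_1 \<eta>_nonneg by (intro mult_left_mono mult_right_mono power_increasing) auto
  finally show ?thesis by (simp add: tuple_const_def mult_ac)
qed simp

end

lemma sum_fun_upd_fibre:
  fixes S :: "('a \<Rightarrow> 'b) set"
  shows "(\<Sum>h\<in>{h\<in>S. h(a := c) = f(a := c)}. g h) = (\<Sum>y\<in>{y. f(a := y) \<in> S}. g (f(a := y)))"
proof -
  have "f(a := h a) = h" if "h(a := c) = f(a := c)" for h
    using that by (metis fun_upd_triv fun_upd_upd)
  then show ?thesis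
    by (intro sum.reindex_bij_witness[where i = "\<lambda>y. f(a := y)" and j = "\<lambda>h. h a"]) auto
qed

lemma sum_le_of_resample_le:
  fixes S :: "('a \<Rightarrow> 'b) set" and g :: "('a \<Rightarrow> 'b) \<Rightarrow> real"
  assumes "finite S"
    and fibre_le: "\<And>f. f \<in> S \<Longrightarrow>
      (\<Sum>y\<in>{y. f(a := y) \<in> S}. g (f(a := y))) \<le> \<kappa> * real (card {y. f(a := y) \<in> S})"
  shows "(\<Sum>f\<in>S. g f) \<le> \<kappa> * real (card S)"
proof -
  let ?\<pi> = "\<lambda>f. f(a := undefined)"
  have "(\<Sum>f\<in>S. g f) = (\<Sum>u\<in>?\<pi> ` S. \<Sum>f\<in>{f\<in>S. ?\<pi> f = u}. g f)"
    using assms(1) by (intro sum.group[symmetric]) auto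
  also have "\<dots> \<le> (\<Sum>u\<in>?\<pi> ` S. \<Sum>f\<in>{f\<in>S. ?\<pi> f = u}. \<kappa>)"
  proof (rule sum_mono)
    fix u assume "u \<in> ?\<pi> ` S"
    then obtain f where f_fibre: "f \<in> S" "u = ?\<pi> f" by auto
    have "(\<Sum>h\<in>{h\<in>S. ?\<pi> h = u}. g h) = (\<Sum>y\<in>{y. f(a := y) \<in> S}. g (f(a := y)))"
      unfolding f_fibre(2) by (rule sum_fun_upd_fibre)
    also have "\<dots> \<le> (\<Sum>y\<in>{y. f(a := y) \<in> S}. \<kappa>)"
      using fibre_le[OF f_fibre(1)] by (simp add: mult.commute)
    also have "\<dots> = (\<Sum>h\<in>{h\<in>S. ?\<pi> h = u}. \<kappa>)"
      unfolding f_fibre(2) by (rule sum_fun_upd_fibre[symmetric])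
    finally show "(\<Sum>h\<in>{h\<in>S. ?\<pi> h = u}. g h) \<le> (\<Sum>h\<in>{h\<in>S. ?\<pi> h = u}. \<kappa>)" .
  qed
  also have "\<dots> = (\<Sum>f\<in>S. \<kappa>)"
    using assms(1) by (intro sum.group) auto
  finally show ?thesis by (simp add: mult.commute)
qed

lemma card_distinct_lists_ge:
  assumes "finite U" "0 \<le> u" "u + real l \<le> real (card U)"
  shows "u ^ l \<le> real (card {ys. length ys = l \<and> distinct ys \<and> set ys \<subseteq> U})"
proof -
  have l_le: "l \<le> card U" using assms by linarith
  have "u ^ l = (\<Prod>i\<in>{card U - l + 1..card U}. u)" using l_le by simp
  also have "\<dots> \<le> (\<Prod>i\<in>{card U - l + 1..card U}. real i)"
    using assms l_le by (intro prod_mono) auto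
  also have "\<dots> = real (card {ys. length ys = l \<and> distinct ys \<and> set ys \<subseteq> U})"
    using card_lists_distinct_length_eq[OF assms(1) l_le] by simp
  finally show ?thesis .
qed

section \<open>Slot assignments\<close>

definition slot_degree :: "nat \<Rightarrow> (nat \<Rightarrow> nat list) \<Rightarrow> nat \<Rightarrow> nat" where
  "slot_degree m nb x = (\<Sum>i<m. count_list (nb i) x)"

lemma slot_assignmentsI:
  assumes "nb \<in> extensional {..<m}" "\<And>i. i < m \<Longrightarrow> length (nb i) = sl i"
    and "\<And>i. i < m \<Longrightarrow> set (nb i) \<subseteq> {..<n}" "\<And>x. x < n \<Longrightarrow> slot_degree m nb x \<le> d"
  shows "nb \<in> slot_assignments n d m sl"
  using assms by (auto simp: slot_assignments_def PiE_def slot_degree_def)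

lemma slot_assignmentsD:
  assumes "nb \<in> slot_assignments n d m sl"
  shows "nb \<in> extensional {..<m}" "i < m \<Longrightarrow> length (nb i) = sl i" "i < m \<Longrightarrow> set (nb i) \<subseteq> {..<n}"
    and "x < n \<Longrightarrow> slot_degree m nb x \<le> d"
  using assms by (auto simp: slot_assignments_def PiE_def Pi_def slot_degree_def)

lemma finite_slot_assignments: "finite (slot_assignments n d m sl)"
proof -
  have "finite {xs :: nat list. length xs = sl i \<and> set xs \<subseteq> {..<n}}" for i
    using finite_lists_length_eq[of "{..<n}" "sl i"] by (simp add: conj_commute)
  then show ?thesis
    unfolding slot_assignments_def by (intro finite_subset[OF Collect_restrict] finite_PiE) auto
qed

lemma finite_resample: "finite {ys. nb(a := ys) \<in> slot_assignments n d m sl}"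
proof (rule finite_imageD)
  show "finite ((\<lambda>ys. nb(a := ys)) ` {ys. nb(a := ys) \<in> slot_assignments n d m sl})"
    by (rule finite_subset[OF _ finite_slot_assignments]) auto
qed (rule inj_onI, metis fun_upd_same)

lemma sum_slot_degree:
  assumes "nb \<in> slot_assignments n d m sl"
  shows "(\<Sum>x<n. slot_degree m nb x) = (\<Sum>i<m. sl i)"
proof -
  have "(\<Sum>x<n. slot_degree m nb x) = (\<Sum>i<m. \<Sum>x<n. count_list (nb i) x)"
    unfolding slot_degree_def by (rule sum.swap)
  also have "\<dots> = (\<Sum>i<m. sl i)"
    using slot_assignmentsD(2,3)[OF assms] by (intro sum.cong) (simp_all add: sum_count_set)
  finally show ?thesis .
qed

lemma card_var_nbhd_le_slot_degree: "card (var_nbhd m nb x) \<le> slot_degree m nb x"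
proof -
  have "card (var_nbhd m nb x) = (\<Sum>i\<in>var_nbhd m nb x. 1)" by simp
  also have "\<dots> \<le> (\<Sum>i\<in>var_nbhd m nb x. count_list (nb i) x)"
    by (intro sum_mono) (auto simp: var_nbhd_def Suc_le_eq count_list_0_iff simp flip: neq0_conv)
  also have "\<dots> \<le> slot_degree m nb x"
    unfolding slot_degree_def by (intro sum_mono2) (auto simp: var_nbhd_def)
  finally show ?thesis .
qed

lemma count_list_distinct_le: "distinct xs \<Longrightarrow> count_list xs x \<le> of_bool (x \<in> set xs)"
  by (induction xs) (auto split: if_splits)

lemma slot_degree_resample_le:
  assumes "a < m"
  shows "slot_degree m (nb(a := ys)) x \<le> count_list ys x + slot_degree m nb x"
proof -
  have "slot_degree m (nb(a := ys)) x = count_list ys x + (\<Sum>i\<in>{..<m} - {a}. count_list (nb i) x)"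
    unfolding slot_degree_def using assms by (subst sum.remove[of _ a]) (auto intro!: sum.cong)
  also have "\<dots> \<le> count_list ys x + slot_degree m nb x"
    unfolding slot_degree_def by (intro add_left_mono sum_mono2) auto
  finally show ?thesis .
qed

lemma resample_unsaturated:
  assumes nb_mem: "nb \<in> slot_assignments n d m sl" and a_less: "a < m"
    and fresh: "length ys = sl a" "distinct ys" "set ys \<subseteq> {x\<in>{..<n}. slot_degree m nb x < d}"
  shows "nb(a := ys) \<in> slot_assignments n d m sl"
proof (rule slot_assignmentsI)
  fix x assume "x < n"
  have "slot_degree m (nb(a := ys)) x \<le> of_bool (x \<in> set ys) + slot_degree m nb x"
    using slot_degree_resample_le[OF a_less, of nb ys x] count_list_distinct_le[OF fresh(2), of x]
    by linarith
  also have "\<dots> \<le> d"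
    using fresh(3) slot_assignmentsD(4)[OF nb_mem \<open>x < n\<close>] by (auto simp: Suc_le_eq)
  finally show "slot_degree m (nb(a := ys)) x \<le> d" .
qed (use slot_assignmentsD(1-3)[OF nb_mem] a_less fresh in \<open>auto simp: extensional_def\<close>)

lemma card_unsaturated_ge:
  assumes nb_mem: "nb \<in> slot_assignments n d m sl" and d_pos: "0 < d"
    and slack: "real (\<Sum>i<m. sl i) \<le> (1 - c) * real d * real n"
  shows "c * real n \<le> real (card {x\<in>{..<n}. slot_degree m nb x < d})"
proof -
  define U where "U = {x\<in>{..<n}. slot_degree m nb x < d}"
  have "U \<subseteq> {..<n}" by (auto simp: U_def)
  then have card_U: "card ({..<n} - U) = n - card U" "card U \<le> n"
    using card_mono[of "{..<n}" U] by (auto simp: card_Diff_subset finite_subset)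
  have "(\<Sum>x\<in>{..<n} - U. d) \<le> (\<Sum>x\<in>{..<n} - U. slot_degree m nb x)"
    by (intro sum_mono) (auto simp: U_def)
  also have "\<dots> \<le> (\<Sum>x<n. slot_degree m nb x)"
    by (intro sum_mono2) auto
  finally have "(n - card U) * d \<le> (\<Sum>i<m. sl i)"
    by (simp add: sum_slot_degree[OF nb_mem] card_U)
  then have "(real n - real (card U)) * real d \<le> real (\<Sum>i<m. sl i)"
    using card_U(2) by (metis of_nat_diff of_nat_le_iff of_nat_mult)
  also note slack
  finally have "(real n - real (card U)) * real d \<le> ((1 - c) * real n) * real d"
    by (simp add: mult_ac)
  then show ?thesis using d_pos by (simp add: algebra_simps U_def)
qed

lemma card_resample_ge:
  fixes c :: real
  assumes nb_mem: "nb \<in> slot_assignments n d m sl" and a_less: "a < m" and d_pos: "0 < d"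
    and slack: "real (\<Sum>i<m. sl i) \<le> (1 - c) * real d * real n"
    and c_nonneg: "0 \<le> c" and n_large: "2 * real (sl a) \<le> c * real n"
  shows "(c * real n / 2) ^ sl a \<le> real (card {ys. nb(a := ys) \<in> slot_assignments n d m sl})"
proof -
  let ?U = "{x\<in>{..<n}. slot_degree m nb x < d}"
  have "(c * real n / 2) ^ sl a \<le> real (card {ys. length ys = sl a \<and> distinct ys \<and> set ys \<subseteq> ?U})"
    using c_nonneg n_large card_unsaturated_ge[OF nb_mem d_pos slack]
    by (intro card_distinct_lists_ge) auto
  also have "\<dots> \<le> real (card {ys. nb(a := ys) \<in> slot_assignments n d m sl})"
    by (intro of_nat_mono card_mono finite_resample) (auto intro!: resample_unsaturated[OF nb_mem a_less])
  finally show ?thesis .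
qed

lemma concat_map_take_drop:
  "concat (map (\<lambda>i. take (sl i) (drop (\<Sum>j<i. sl j) xs)) [0..<m]) = take (\<Sum>i<m. sl i) xs"
  by (induction m) (simp_all add: take_add)

text \<open>Cutting the list that repeats every variable node \<open>d\<close> times into consecutive blocks gives an
  assignment.\<close>

lemma slot_assignments_nonempty:
  assumes total: "(\<Sum>i<m. sl i) \<le> d * n"
  shows "slot_assignments n d m sl \<noteq> {}"
proof -
  define xs where "xs = concat (replicate d [0..<n])"
  define block where "block i = take (sl i) (drop (\<Sum>j<i. sl j) xs)" for i
  have "length xs = d * n"
    unfolding xs_def by (induction d) simp_all
  have length_block: "length (block i) = sl i" if "i < m" for i
  proof -
    have "(\<Sum>j<i. sl j) + sl i \<le> (\<Sum>j<m. sl j)"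
      using sum_mono2[of "{..<m}" "{..<Suc i}" sl] that by auto
    then show ?thesis using total by (simp add: block_def \<open>length xs = d * n\<close>)
  qed
  have "set xs \<subseteq> {..<n}"
    by (auto simp: xs_def)
  then have set_block: "set (block i) \<subseteq> {..<n}" for i
    unfolding block_def by (meson order_trans set_drop_subset set_take_subset)
  have slot_degree_le: "slot_degree m (restrict block {..<m}) x \<le> d" for x
  proof -
    have "slot_degree m (restrict block {..<m}) x = count_list (concat (map block [0..<m])) x"
      unfolding slot_degree_def by (induction m) simp_all
    also have "\<dots> = count_list (take (\<Sum>i<m. sl i) xs) x"
      unfolding block_def concat_map_take_drop ..
    also have "\<dots> \<le> count_list xs x"
      by (metis append_take_drop_id count_list_append le_add1)
    also have "\<dots> \<le> d"
    proof -
      have "count_list [0..<n] x \<le> 1"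
        using count_list_distinct_le[of "[0..<n]" x] by (rule order_trans) auto
      then show ?thesis unfolding xs_def by (induction d) auto
    qed
    finally show ?thesis .
  qed
  have "restrict block {..<m} \<in> slot_assignments n d m sl"
    using length_block set_block slot_degree_le by (intro slot_assignmentsI) auto
  then show ?thesis by blast
qed

section \<open>Averaging over the slot assignments\<close>

definition factor_const :: "real \<Rightarrow> nat \<Rightarrow> nat \<Rightarrow> real \<Rightarrow> real \<Rightarrow> real" where
  "factor_const q d k K c = tuple_const q d k K * (K\<^sup>2 * (q * sqrt 2)) * (2 / c) ^ k"

definition total_const :: "real \<Rightarrow> nat \<Rightarrow> nat \<Rightarrow> real \<Rightarrow> real \<Rightarrow> real" where
  "total_const q d k K c = bp_const d K * (real d * factor_const q d k K c)"

lemma factor_const_nonneg: "0 \<le> q \<Longrightarrow> 0 \<le> K \<Longrightarrow> 0 < c \<Longrightarrow> 0 \<le> factor_const q d k K c"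
  by (simp add: factor_const_def tuple_const_nonneg)

lemma bp_const_nonneg: "0 \<le> K \<Longrightarrow> 0 \<le> bp_const d K"
  by (simp add: bp_const_def)

lemma total_const_nonneg: "0 \<le> q \<Longrightarrow> 0 \<le> K \<Longrightarrow> 0 < c \<Longrightarrow> 0 \<le> total_const q d k K c"
  by (simp add: total_const_def bp_const_nonneg factor_const_nonneg)

locale sparse_slots =
  fixes n m d k :: nat and sl :: "nat \<Rightarrow> nat" and w :: "nat \<Rightarrow> 'w::finite list \<Rightarrow> real" and K c :: real
  assumes K_ge_1: "1 \<le> K"
    and weights: "\<And>i ts. i < m \<Longrightarrow> length ts = sl i \<Longrightarrow> 1 / K \<le> w i ts \<and> w i ts \<le> K"
    and d_pos: "0 < d" and sl_le: "\<And>i. i < m \<Longrightarrow> sl i \<le> k"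
    and slack: "real (\<Sum>i<m. sl i) \<le> (1 - c) * real d * real n" and c_bounds: "0 < c" "c \<le> 1"
    and n_large: "2 * real k \<le> c * real n"
begin

abbreviation assignments :: "(nat \<Rightarrow> nat list) set" where
  "assignments \<equiv> slot_assignments n d m sl"

abbreviation small_tv :: "real \<Rightarrow> (nat \<Rightarrow> nat list) \<Rightarrow> bool" where
  "small_tv \<delta> nb \<equiv> tv_total n (m, nb, w) \<le> \<delta> * (real n)\<^sup>2"

abbreviation factor_error :: "nat \<Rightarrow> (nat \<Rightarrow> nat list) \<Rightarrow> real" where
  "factor_error a nb \<equiv> (\<Sum>x\<in>set (nb a). edge_error n m nb w x a)"

lemma bounded_factor_graph:
  assumes "nb \<in> assignments"
  shows "bounded_factor_graph n m d nb w K"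
proof
  show "weights_bdd K nb w {..<m}"
    using K_ge_1 weights slot_assignmentsD(2)[OF assms] by (simp add: weights_bdd_def)
  show "card (var_nbhd m nb x) \<le> d" if "x < n" for x
    using card_var_nbhd_le_slot_degree slot_assignmentsD(4)[OF assms that] by (rule order_trans)
qed

lemma mixing_of_small_tv_resample:
  assumes "nb(a := ys) \<in> assignments" "a < m" and small: "small_tv \<delta> (nb(a := ys))"
  shows "mixing {..<n} (gibbs_pmf n nb w ({..<m} - {a}))
    (marginals (gibbs_pmf n (nb(a := ys)) w {..<m})) (K\<^sup>2 * (real CARD('w) * sqrt (2 * \<delta>)))"
proof -
  interpret bounded_factor_graph n m d "nb(a := ys)" w K
    by (rule bounded_factor_graph[OF assms(1)])
  have "mixing {..<n} (gibbs_pmf n (nb(a := ys)) w ({..<m} - {a}))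
      (marginals (gibbs_pmf n (nb(a := ys)) w {..<m})) ((K ^ 1)\<^sup>2 * (real CARD('w) * sqrt (2 * \<delta>)))"
    using assms(2)
    by (intro mixing_gibbs_delete[OF weights_bdd] mixing_gibbs_of_tv_total positive_subset small) auto
  then show ?thesis by (simp add: gibbs_pmf_resample)
qed

lemma sum_factor_error_resample_le:
  assumes nb_mem: "nb \<in> assignments" and a_less: "a < m" and \<delta>_nonneg: "0 \<le> \<delta>"
    and mixing: "mixing {..<n} (gibbs_pmf n nb w ({..<m} - {a})) v (K\<^sup>2 * (real CARD('w) * sqrt (2 * \<delta>)))"
  shows "(\<Sum>ys\<in>{ys. nb(a := ys) \<in> assignments}. factor_error a (nb(a := ys)))
    \<le> real (sl a) * factor_const (real CARD('w)) d k K c * sqrt \<delta>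
      * real (card {ys. nb(a := ys) \<in> assignments})"
proof -
  interpret bounded_factor_graph n m d nb w K by (rule bounded_factor_graph[OF nb_mem])
  let ?A = "{ys. nb(a := ys) \<in> assignments}" and ?\<eta> = "K\<^sup>2 * (real CARD('w) * sqrt (2 * \<delta>))"
  let ?C = "tuple_const (real CARD('w)) d k K"
  have \<eta>_nonneg: "0 \<le> ?\<eta>" using \<delta>_nonneg by simp
  have C_nonneg: "0 \<le> ?C" using K_ge_1 by (simp add: tuple_const_nonneg)
  have "?A \<subseteq> tuples {..<n} (sl a)"
    using slot_assignmentsD(2,3)[of _ n d m sl a] a_less by fastforce
  then have "(\<Sum>ys\<in>?A. factor_error a (nb(a := ys)))
    \<le> (\<Sum>ys\<in>tuples {..<n} (sl a). factor_error a (nb(a := ys)))"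
    by (intro sum_mono2) (auto intro!: sum_nonneg finite_lists_length_eq)
  also have "\<dots> \<le> real (sl a) * (?C * ?\<eta> * real n ^ sl a)"
    using sum_edge_error_resample_le[OF a_less mixing \<eta>_nonneg sl_le[OF a_less]] by simp
  also have "real n ^ sl a = (2 / c) ^ sl a * (c * real n / 2) ^ sl a"
    using c_bounds by (simp flip: power_mult_distrib)
  also have "real (sl a) * (?C * ?\<eta> * \<dots>) \<le> real (sl a) * (?C * ?\<eta> * ((2 / c) ^ k * real (card ?A)))"
  proof (intro mult_left_mono mult_mono power_increasing sl_le a_less)
    show "(c * real n / 2) ^ sl a \<le> real (card ?A)"
      using n_large sl_le[OF a_less] c_bounds
      by (intro card_resample_ge[OF nb_mem a_less d_pos slack]) auto
  qed (use c_bounds C_nonneg \<eta>_nonneg in auto)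
  also have "\<dots> = real (sl a) * factor_const (real CARD('w)) d k K c * sqrt \<delta> * real (card ?A)"
    by (simp add: factor_const_def real_sqrt_mult mult_ac)
  finally show ?thesis .
qed

lemma sum_factor_error_le:
  assumes a_less: "a < m" and \<delta>_nonneg: "0 \<le> \<delta>"
  shows "(\<Sum>nb\<in>assignments. of_bool (small_tv \<delta> nb) * factor_error a nb)
    \<le> real (sl a) * factor_const (real CARD('w)) d k K c * sqrt \<delta> * real (card assignments)"
proof (rule sum_le_of_resample_le[OF finite_slot_assignments])
  fix nb assume nb_mem: "nb \<in> assignments"
  let ?A = "{ys. nb(a := ys) \<in> assignments}"
  let ?\<kappa> = "real (sl a) * factor_const (real CARD('w)) d k K c * sqrt \<delta>"
  let ?sum = "\<Sum>ys\<in>?A. of_bool (small_tv \<delta> (nb(a := ys))) * factor_error a (nb(a := ys))"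
  show "?sum \<le> ?\<kappa> * real (card ?A)"
  proof (cases "\<exists>ys\<in>?A. small_tv \<delta> (nb(a := ys))")
    case True
    then obtain ys where "nb(a := ys) \<in> assignments" "small_tv \<delta> (nb(a := ys))" by blast
    note mixing = mixing_of_small_tv_resample[OF this(1) a_less this(2)]
    have "?sum \<le> (\<Sum>ys\<in>?A. factor_error a (nb(a := ys)))"
      by (intro sum_mono) (auto simp: of_bool_def intro!: sum_nonneg)
    also have "\<dots> \<le> ?\<kappa> * real (card ?A)"
      by (rule sum_factor_error_resample_le[OF nb_mem a_less \<delta>_nonneg mixing])
    finally show ?thesis .
  next
    case False
    then have "?sum = 0" by (intro sum.neutral) auto
    also have "0 \<le> ?\<kappa> * real (card ?A)"
      using K_ge_1 c_bounds \<delta>_nonneg by (simp add: factor_const_nonneg)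
    finally show ?thesis .
  qed
qed

lemma bp_error_le_sum_factor_error:
  assumes nb_mem: "nb \<in> assignments"
  shows "bp_error n (m, nb, w) \<le> bp_const d K * (\<Sum>a<m. factor_error a nb)"
proof -
  interpret bounded_factor_graph n m d nb w K by (rule bounded_factor_graph[OF nb_mem])
  have "(\<Sum>x<n. \<Sum>a\<in>N x. edge_error n m nb w x a)
    = (\<Sum>a<m. \<Sum>x\<in>{x\<in>{..<n}. x \<in> set (nb a)}. edge_error n m nb w x a)"
    unfolding var_nbhd_def by (rule sum.swap_restrict) auto
  also have "\<dots> = (\<Sum>a<m. factor_error a nb)"
    using slot_assignmentsD(3)[OF nb_mem] by (intro sum.cong refl) blast
  finally show ?thesis using bp_error_le by simp
qed

lemma sum_bp_error_le:
  assumes \<delta>_nonneg: "0 \<le> \<delta>"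
  shows "(\<Sum>nb\<in>assignments. of_bool (small_tv \<delta> nb) * bp_error n (m, nb, w))
    \<le> total_const (real CARD('w)) d k K c * sqrt \<delta> * real n * real (card assignments)"
proof -
  let ?C = "factor_const (real CARD('w)) d k K c" and ?b = "bp_const d K"
  have b_nonneg: "0 \<le> ?b" and C_nonneg: "0 \<le> ?C" using K_ge_1 c_bounds
    by (simp_all add: bp_const_nonneg factor_const_nonneg)
  have "(\<Sum>nb\<in>assignments. of_bool (small_tv \<delta> nb) * bp_error n (m, nb, w))
    \<le> (\<Sum>nb\<in>assignments. of_bool (small_tv \<delta> nb) * (?b * (\<Sum>a<m. factor_error a nb)))"
    by (intro sum_mono mult_left_mono bp_error_le_sum_factor_error) auto
  also have "\<dots> = ?b * (\<Sum>a<m. \<Sum>nb\<in>assignments. of_bool (small_tv \<delta> nb) * factor_error a nb)"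
    by (subst sum.swap) (simp add: sum_distrib_left mult_ac)
  also have "\<dots> \<le> ?b * (\<Sum>a<m. real (sl a) * ?C * sqrt \<delta> * real (card assignments))"
    using \<delta>_nonneg b_nonneg by (intro mult_left_mono sum_mono sum_factor_error_le) auto
  also have "\<dots> = ?b * (real (\<Sum>a<m. sl a) * (?C * sqrt \<delta> * real (card assignments)))"
    by (simp add: sum_distrib_right mult.assoc)
  also have "\<dots> \<le> ?b * ((real d * real n) * (?C * sqrt \<delta> * real (card assignments)))"
  proof (intro mult_left_mono mult_right_mono)
    have "(1 - c) * real d * real n \<le> 1 * real d * real n" using c_bounds
      by (intro mult_right_mono) auto
    with slack show "real (\<Sum>a<m. sl a) \<le> real d * real n" by simp
  qed (use b_nonneg C_nonneg \<delta>_nonneg in auto)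
  finally show ?thesis by (simp add: total_const_def mult_ac)
qed

end

section \<open>The percolated regular model\<close>

lemma exists_nths_eq:
  assumes "J \<subseteq> {..<k}" "length ts = card J"
  shows "\<exists>\<tau>. length \<tau> = k \<and> nths \<tau> J = ts"
  using assms
proof (induction k arbitrary: J ts)
  case (Suc k)
  define J' where "J' = {j. Suc j \<in> J}"
  have J'_sub: "J' \<subseteq> {..<k}" and finite_J: "finite J"
    using Suc.prems(1) by (auto simp: J'_def intro: finite_subset)
  have "J - {0} = Suc ` J'"
    by (auto simp: J'_def image_iff) (metis not0_implies_Suc)
  then have card_J': "card J' = card (J - {0})"
    by (simp add: card_image)
  show ?case
  proof (cases "0 \<in> J")
    case True
    then obtain t us where ts_eq: "ts = t # us" "length us = card J'"
      using Suc.prems(2) finite_J card_J' by (cases ts) (auto simp: card_eq_0_iff)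
    from Suc.IH[OF J'_sub ts_eq(2)] obtain \<tau> where "length \<tau> = k" "nths \<tau> J' = us" by blast
    then show ?thesis
      using True ts_eq by (intro exI[of _ "t # \<tau>"]) (simp add: nths_Cons J'_def)
  next
    case False
    then have "length ts = card J'" using Suc.prems(2) card_J' by simp
    from Suc.IH[OF J'_sub this] obtain \<tau> where "length \<tau> = k" "nths \<tau> J' = ts" by blast
    then show ?thesis
      using False by (intro exI[of _ "undefined # \<tau>"]) (simp add: nths_Cons J'_def)
  qed
qed simp

lemma psi_restrict_pos:
  fixes psi :: "'w::finite list \<Rightarrow> real"
  assumes "J \<subseteq> {..<k}" "length ts = card J" and psi_pos: "\<And>\<tau>. length \<tau> = k \<Longrightarrow> 0 < psi \<tau>"
  shows "0 < psi_restrict k psi J ts"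
  unfolding psi_restrict_def
proof (intro mult_pos_pos sum_pos)
  show "finite {\<tau> :: 'w list. length \<tau> = k \<and> nths \<tau> J = ts}"
    by (rule finite_subset[OF _ finite_lists_length_eq[of UNIV k]]) auto
  show "{\<tau>. length \<tau> = k \<and> nths \<tau> J = ts} \<noteq> {}" using exists_nths_eq[OF assms(1,2)] by auto
qed (use psi_pos in auto)

lemma finite_pos_bounds:
  fixes A :: "real set"
  assumes "finite A" and A_pos: "\<And>x. x \<in> A \<Longrightarrow> 0 < x"
  shows "\<exists>K\<ge>1. \<forall>x\<in>A. 1 / K \<le> x \<and> x \<le> K"
proof (intro exI conjI ballI)
  let ?B = "insert 1 (A \<union> inverse ` A)"
  show "1 \<le> Max ?B" using assms(1) by simp
  fix x assume "x \<in> A"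
  then show "x \<le> Max ?B" using assms(1) by (auto intro!: Max_ge)
  have "inverse x \<le> Max ?B" using \<open>x \<in> A\<close> assms(1) by (auto intro!: Max_ge)
  then show "1 / Max ?B \<le> x"
    using A_pos[OF \<open>x \<in> A\<close>] \<open>1 \<le> Max ?B\<close> by (simp add: field_simps)
qed

lemma psi_restrict_bounds:
  fixes \<Psi> :: "('w::finite list \<Rightarrow> real) set"
  assumes "finite \<Psi>" and psi_pos: "\<forall>psi\<in>\<Psi>. \<forall>\<tau>. length \<tau> = k \<longrightarrow> 0 < psi \<tau>"
  obtains K where "1 \<le> K" "\<And>psi J ts. psi \<in> \<Psi> \<Longrightarrow> J \<subseteq> {..<k} \<Longrightarrow> length ts = card J \<Longrightarrow>
      1 / K \<le> psi_restrict k psi J ts \<and> psi_restrict k psi J ts \<le> K"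
proof -
  let ?I = "\<Psi> \<times> (SIGMA J : Pow {..<k}. {ts :: 'w list. set ts \<subseteq> UNIV \<and> length ts = card J})"
  define A where "A = (\<lambda>(psi, J, ts). psi_restrict k psi J ts) ` ?I"
  have "finite A"
    unfolding A_def using assms(1)
    by (intro finite_imageI finite_cartesian_product finite_SigmaI finite_lists_length_eq) auto
  moreover have "0 < x" if "x \<in> A" for x
    using that psi_pos by (auto simp: A_def intro!: psi_restrict_pos)
  ultimately obtain K where "1 \<le> K" "\<forall>x\<in>A. 1 / K \<le> x \<and> x \<le> K"
    using finite_pos_bounds[of A] by blast
  moreover have "psi_restrict k psi J ts \<in> A" if "psi \<in> \<Psi>" "J \<subseteq> {..<k}" "length ts = card J" for psi J ts
    unfolding A_def using that by (intro image_eqI[of _ _ "(psi, J, ts)"]) auto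
  ultimately show thesis using that by blast
qed

text \<open>\<open>bernoulli_pmf\<close> truncates its parameter to the unit interval, so the model does not change
  when a retention parameter \<open>eps > 1\<close> is replaced by \<open>1\<close>.\<close>

lemma J_pmf_min: "J_pmf k eps = J_pmf k (min eps 1)"
proof -
  have "bernoulli_pmf (1 - eps) = bernoulli_pmf (1 - min eps 1)"
    by (rule pmf_eqI) (simp add: bernoulli_pmf.rep_eq min_def)
  then show ?thesis by (simp add: J_pmf_def)
qed

lemma reg_model_min: "reg_model d k eps \<rho> = reg_model d k (min eps 1) \<rho>"
  unfolding reg_model_def reg_stage1_def J_pmf_min[of k eps] ..

subsection \<open>Tail bound for the number of slots\<close>

lemma nn_integral_exp_card_J:
  fixes t eps :: real
  assumes "0 \<le> eps" "eps \<le> 1"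
  shows "(\<integral>\<^sup>+J. ennreal (exp (t * real (card J))) \<partial>J_pmf k eps) = ennreal ((eps + (1 - eps) * exp t) ^ k)"
proof -
  have "(\<integral>\<^sup>+J. ennreal (exp (t * real (card J))) \<partial>J_pmf k eps)
    = (\<integral>\<^sup>+b. (\<Prod>j<k. ennreal (exp (t * of_bool (b j)))) \<partial>Pi_pmf {..<k} False (\<lambda>_. bernoulli_pmf (1 - eps)))"
    unfolding J_pmf_def nn_integral_map_pmf
  proof (rule nn_integral_cong)
    fix b :: "nat \<Rightarrow> bool"
    have "real (card {j\<in>{..<k}. b j}) = (\<Sum>j<k. of_bool (b j))"
      by (simp add: of_bool_def sum.If_cases Int_def)
    then have "exp (t * real (card {j\<in>{..<k}. b j})) = (\<Prod>j<k. exp (t * of_bool (b j)))"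
      by (simp only: sum_distrib_left exp_sum[OF finite_lessThan])
    then show "ennreal (exp (t * real (card {j\<in>{..<k}. b j}))) = (\<Prod>j<k. ennreal (exp (t * of_bool (b j))))"
      by (simp add: prod_ennreal)
  qed
  also have "\<dots> = (\<Prod>j<k. \<integral>\<^sup>+b. ennreal (exp (t * of_bool b)) \<partial>bernoulli_pmf (1 - eps))"
    by (rule nn_integral_prod_Pi_pmf) simp
  also have "(\<integral>\<^sup>+b. ennreal (exp (t * of_bool b)) \<partial>bernoulli_pmf (1 - eps))
      = ennreal (exp t) * ennreal (1 - eps) + ennreal 1 * ennreal eps"
    using assms
    by (subst nn_integral_measure_pmf_support[of UNIV]) (auto simp: UNIV_bool add.commute)
  also have "\<dots> = ennreal (eps + (1 - eps) * exp t)"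
    using assms by (simp add: ennreal_mult ennreal_plus mult.commute add.commute flip: ennreal_mult)
  finally show ?thesis using assms by (simp add: ennreal_power del: ennreal_plus)
qed

lemma nn_integral_power_poisson:
  assumes "0 < r" "0 \<le> z"
  shows "(\<integral>\<^sup>+m. ennreal z ^ m \<partial>poisson_pmf r) = ennreal (exp (r * (z - 1)))"
proof -
  let ?term = "\<lambda>m. (r * z) ^ m / fact m * exp (- r)"
  have sums: "?term sums (exp (r * z) * exp (- r))"
    using exp_converges[of "r * z"] by (intro sums_mult2) (simp add: divide_inverse mult.commute)
  have "(\<integral>\<^sup>+m. ennreal z ^ m \<partial>poisson_pmf r) = (\<integral>\<^sup>+m. ennreal (?term m) \<partial>count_space UNIV)"
    unfolding nn_integral_measure_pmf using assms
    by (intro nn_integral_cong)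
      (simp add: ennreal_power ennreal_mult[symmetric] power_mult_distrib mult_ac)
  also have "\<dots> = (\<Sum>m. ennreal (?term m))"
    by (rule nn_integral_count_space_nat)
  also have "\<dots> = ennreal (exp (r * z) * exp (- r))"
    using assms sums by (intro suminf_ennreal_eq) auto
  finally show ?thesis by (simp add: exp_add[symmetric] algebra_simps)
qed

definition compound_poisson_pmf :: "real \<Rightarrow> 'b \<Rightarrow> 'b pmf \<Rightarrow> (nat \<times> (nat \<Rightarrow> 'b)) pmf" where
  "compound_poisson_pmf r dflt p =
     bind_pmf (poisson_pmf r) (\<lambda>m. map_pmf (\<lambda>c. (m, c)) (Pi_pmf {..<m} dflt (\<lambda>_. p)))"

lemma nn_integral_compound_poisson:
  fixes p :: "'b pmf"
  assumes "0 < r" "0 \<le> z" and integral_g: "(\<integral>\<^sup>+y. g y \<partial>p) = ennreal z"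
  shows "(\<integral>\<^sup>+x. (\<Prod>i<fst x. g (snd x i)) \<partial>compound_poisson_pmf r dflt p) = ennreal (exp (r * (z - 1)))"
proof -
  have "(\<integral>\<^sup>+c. (\<Prod>i<m. g (c i)) \<partial>Pi_pmf {..<m} dflt (\<lambda>_. p)) = ennreal z ^ m" for m
    using nn_integral_prod_Pi_pmf[of "{..<m}" dflt "\<lambda>_. p" "\<lambda>_. g"] by (simp add: integral_g)
  then show ?thesis
    using nn_integral_power_poisson[OF assms(1,2)] by (simp add: compound_poisson_pmf_def)
qed

type_synonym 'w stage1_outcome = "nat \<times> (nat \<Rightarrow> nat set \<times> ('w list \<Rightarrow> real))"

definition slot_total :: "'w stage1_outcome \<Rightarrow> nat" where
  "slot_total = (\<lambda>(m, c). \<Sum>i<m. card (fst (c i)))"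

abbreviation free_stage1 ::
    "nat \<Rightarrow> nat \<Rightarrow> real \<Rightarrow> ('w list \<Rightarrow> real) pmf \<Rightarrow> nat \<Rightarrow> 'w stage1_outcome pmf" where
  "free_stage1 d k eps \<rho> n \<equiv>
     compound_poisson_pmf (real d * real n / real k) undefined (pair_pmf (J_pmf k eps) \<rho>)"

lemma reg_stage1_eq:
  "reg_stage1 d k eps \<rho> n = cond_pmf (free_stage1 d k eps \<rho> n) {z. slot_total z \<le> d * n}"
  by (simp add: reg_stage1_def compound_poisson_pmf_def slot_total_def case_prod_unfold)

lemma nn_integral_exp_slot_total:
  fixes \<rho> :: "('w list \<Rightarrow> real) pmf"
  assumes eps_bounds: "0 \<le> eps" "eps \<le> 1" and "0 < d" "0 < k" "0 < n"
  shows "(\<integral>\<^sup>+z. ennreal (exp (t * real (slot_total z))) \<partial>free_stage1 d k eps \<rho> n)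
    = ennreal (exp (real d * real n / real k * ((eps + (1 - eps) * exp t) ^ k - 1)))"
proof -
  let ?g = "\<lambda>y :: nat set \<times> ('w list \<Rightarrow> real). ennreal (exp (t * real (card (fst y))))"
  have "(\<integral>\<^sup>+y. ?g y \<partial>pair_pmf (J_pmf k eps) \<rho>)
    = (\<integral>\<^sup>+J. ennreal (exp (t * real (card J))) \<partial>map_pmf fst (pair_pmf (J_pmf k eps) \<rho>))"
    by simp
  also have "\<dots> = ennreal ((eps + (1 - eps) * exp t) ^ k)"
    unfolding map_fst_pair_pmf by (rule nn_integral_exp_card_J[OF eps_bounds])
  finally have "(\<integral>\<^sup>+z. (\<Prod>i<fst z. ?g (snd z i)) \<partial>free_stage1 d k eps \<rho> n)
    = ennreal (exp (real d * real n / real k * ((eps + (1 - eps) * exp t) ^ k - 1)))"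
    using assms by (intro nn_integral_compound_poisson) auto
  moreover have "ennreal (exp (t * real (slot_total z))) = (\<Prod>i<fst z. ?g (snd z i))" for z
    by (simp add: slot_total_def case_prod_unfold sum_distrib_left exp_sum prod_ennreal)
  ultimately show ?thesis by simp
qed

lemma exists_chernoff_exponent:
  fixes e :: real and k :: nat
  assumes "0 < e" "0 < k"
  obtains t where "0 < t" "((e + (1 - e) * exp t) ^ k - 1) / real k < t * (1 - e / 2)"
proof -
  let ?f = "\<lambda>t. ((e + (1 - e) * exp t) ^ k - 1) / real k - t * (1 - e / 2)"
  have "(?f has_real_derivative - (e / 2)) (at 0)"
    using assms by (auto intro!: derivative_eq_intros simp: field_simps)
  from DERIV_neg_dec_right[OF this] assms obtain \<epsilon> where
    decreasing: "0 < \<epsilon>" "\<And>h. 0 < h \<Longrightarrow> h < \<epsilon> \<Longrightarrow> ?f (0 + h) < ?f 0"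
    by auto
  then have "?f (0 + \<epsilon> / 2) < ?f 0" by (intro decreasing(2)) auto
  with decreasing(1) show thesis by (intro that[of "\<epsilon> / 2"]) auto
qed

definition excess_slots :: "nat \<Rightarrow> real \<Rightarrow> nat \<Rightarrow> 'w stage1_outcome set" where
  "excess_slots d eps n = {z. (1 - eps / 2) * real d * real n \<le> real (slot_total z)}"

lemma compl_excess_slots_subset:
  assumes "0 \<le> eps"
  shows "- excess_slots d eps n \<subseteq> {z. slot_total z \<le> d * n}"
proof
  fix z assume "z \<in> - excess_slots d eps n"
  then have "real (slot_total z) \<le> (1 - eps / 2) * (real d * real n)"
    by (simp add: excess_slots_def)
  also have "\<dots> \<le> 1 * (real d * real n)" using assms by (intro mult_right_mono) auto
  finally show "z \<in> {z. slot_total z \<le> d * n}" by (simp flip: of_nat_mult)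
qed

lemma free_stage1_excess_slots_le:
  fixes \<rho> :: "('w list \<Rightarrow> real) pmf"
  assumes eps_bounds: "0 < eps" "eps \<le> 1" and "0 < d" "0 < k"
  obtains \<beta> where "0 < \<beta>"
    "\<And>n. 0 < n \<Longrightarrow> measure_pmf.prob (free_stage1 d k eps \<rho> n) (excess_slots d eps n) \<le> exp (- \<beta> * real n)"
proof -
  define \<phi> where "\<phi> t = (eps + (1 - eps) * exp t) ^ k - 1" for t
  obtain t where exponent: "0 < t" "\<phi> t / real k < t * (1 - eps / 2)"
    using exists_chernoff_exponent[OF eps_bounds(1) \<open>0 < k\<close>] unfolding \<phi>_def .
  define \<beta> where "\<beta> = (t * (1 - eps / 2) - \<phi> t / real k) * real d"
  show thesis
  proof
    show "0 < \<beta>" using exponent assms by (simp add: \<beta>_def)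
    fix n :: nat assume "0 < n"
    let ?p = "free_stage1 d k eps \<rho> n" and ?u = "(1 - eps / 2) * real d * real n"
    have "emeasure ?p (excess_slots d eps n)
      \<le> ennreal (exp (- t * ?u)) * (\<integral>\<^sup>+z. ennreal (exp (t * real (slot_total z))) \<partial>?p)"
      using Chernoff_ineq_nn_integral_ge[OF exponent(1),
          of UNIV "measure_pmf ?p" "\<lambda>z. real (slot_total z)" ?u]
      by (simp add: excess_slots_def)
    also have "\<dots> = ennreal (exp (- t * ?u) * exp (real d * real n / real k * \<phi> t))"
      using nn_integral_exp_slot_total[of eps d k n \<rho> t] assms \<open>0 < n\<close>
      by (simp add: \<phi>_def ennreal_mult)
    also have "exp (- t * ?u) * exp (real d * real n / real k * \<phi> t) = exp (- \<beta> * real n)"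
      by (simp add: \<beta>_def exp_add[symmetric] algebra_simps)
    finally show "measure_pmf.prob ?p (excess_slots d eps n) \<le> exp (- \<beta> * real n)"
      by (simp add: measure_pmf.emeasure_eq_measure)
  qed
qed

lemma prob_cond_pmf_le:
  assumes "set_pmf p \<inter> S \<noteq> {}" and "- A \<subseteq> S" and "measure_pmf.prob p A < 1"
  shows "measure_pmf.prob (cond_pmf p S) A \<le> measure_pmf.prob p A / (1 - measure_pmf.prob p A)"
proof -
  have "measure_pmf.prob (cond_pmf p S) A = measure_pmf.prob p (S \<inter> A) / measure_pmf.prob p S"
    unfolding cond_pmf.rep_eq[OF assms(1)] using emeasure_measure_pmf_not_zero[OF assms(1)]
    by (subst measure_uniform_measure) (auto simp: measure_pmf.emeasure_eq_measure)
  also have "\<dots> \<le> measure_pmf.prob p A / (1 - measure_pmf.prob p A)"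
  proof (rule frac_le)
    have "1 - measure_pmf.prob p A = measure_pmf.prob p (- A)"
      using measure_pmf.prob_compl[of A p] by (simp add: Compl_eq_Diff_UNIV)
    also have "\<dots> \<le> measure_pmf.prob p S"
      using assms(2) by (intro measure_pmf.finite_measure_mono) auto
    finally show "1 - measure_pmf.prob p A \<le> measure_pmf.prob p S" .
  qed (use assms(3) in \<open>auto intro: measure_pmf.finite_measure_mono\<close>)
  finally show ?thesis .
qed

lemma free_stage1_meets:
  assumes "0 < d" "0 < k" "0 < n"
  shows "set_pmf (free_stage1 d k eps \<rho> n) \<inter> {z. slot_total z \<le> d * n} \<noteq> {}"
proof -
  have "(0, \<lambda>_. undefined) \<in> set_pmf (free_stage1 d k eps \<rho> n)"
    using assms by (auto simp: compound_poisson_pmf_def intro!: exI[of _ 0])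
  then show ?thesis by (force simp: slot_total_def)
qed

lemma prob_excess_slots_tendsto_0:
  fixes \<rho> :: "('w list \<Rightarrow> real) pmf"
  assumes eps_bounds: "0 < eps" "eps \<le> 1" and d_pos: "0 < d" and k_pos: "0 < k"
  shows "(\<lambda>n. measure_pmf.prob (reg_stage1 d k eps \<rho> n) (excess_slots d eps n)) \<longlonglongrightarrow> 0"
proof -
  let ?P = "\<lambda>n. measure_pmf.prob (free_stage1 d k eps \<rho> n) (excess_slots d eps n)"
  obtain \<beta> where exp_bound: "0 < \<beta>" "\<And>n. 0 < n \<Longrightarrow> ?P n \<le> exp (- \<beta> * real n)"
    using free_stage1_excess_slots_le[OF assms, of \<rho>] by blast
  have exp_tendsto_0: "(\<lambda>n. exp (- \<beta> * real n)) \<longlonglongrightarrow> 0"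
    unfolding exp_of_nat2_mult using exp_bound(1) by (intro LIMSEQ_realpow_zero) auto
  have "\<forall>\<^sub>F n in sequentially. ?P n \<le> exp (- \<beta> * real n)"
    using eventually_gt_at_top[of 0] by (rule eventually_mono) (rule exp_bound(2))
  then have free_tendsto_0: "?P \<longlonglongrightarrow> 0"
    by (rule tendsto_sandwich[OF _ _ tendsto_const exp_tendsto_0, rotated]) simp
  have "\<forall>\<^sub>F n in sequentially.
      measure_pmf.prob (reg_stage1 d k eps \<rho> n) (excess_slots d eps n) \<le> ?P n / (1 - ?P n)"
    using order_tendstoD(2)[OF free_tendsto_0 zero_less_one] eventually_gt_at_top[of 0]
  proof eventually_elim
    case (elim n)
    then show ?case
      unfolding reg_stage1_eq using eps_bounds(1)
      by (intro prob_cond_pmf_le[OF free_stage1_meets[OF d_pos k_pos] compl_excess_slots_subset]) simp_all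
  qed
  moreover have "(\<lambda>n. ?P n / (1 - ?P n)) \<longlonglongrightarrow> 0"
    using tendsto_divide[OF free_tendsto_0 tendsto_diff[OF tendsto_const free_tendsto_0, of 1]]
    by simp
  ultimately show ?thesis by (rule tendsto_sandwich[OF _ _ tendsto_const, rotated]) simp
qed

subsection \<open>Belief Propagation on the random graph\<close>

abbreviation stage1_slots :: "(nat \<Rightarrow> nat set \<times> ('w list \<Rightarrow> real)) \<Rightarrow> nat \<Rightarrow> nat" where
  "stage1_slots c \<equiv> (\<lambda>i. card (fst (c i)))"

abbreviation stage1_weights ::
    "nat \<Rightarrow> (nat \<Rightarrow> nat set \<times> ('w::finite list \<Rightarrow> real)) \<Rightarrow> nat \<Rightarrow> 'w list \<Rightarrow> real" where
  "stage1_weights k c \<equiv> (\<lambda>i. psi_restrict k (snd (c i)) (fst (c i)))"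

definition attach_slots :: "nat \<Rightarrow> nat \<Rightarrow> nat \<Rightarrow> 'w::finite stage1_outcome \<Rightarrow> 'w fgraph pmf" where
  "attach_slots n d k = (\<lambda>(m, c). map_pmf (\<lambda>nb. (m, nb, stage1_weights k c))
     (pmf_of_set (slot_assignments n d m (stage1_slots c))))"

lemma reg_model_eq_bind: "reg_model d k eps \<rho> n = bind_pmf (reg_stage1 d k eps \<rho> n) (attach_slots n d k)"
  by (simp add: reg_model_def attach_slots_def)

lemma set_pmf_attach_slots:
  assumes "slot_total (m, c) \<le> d * n"
  shows "set_pmf (attach_slots n d k (m, c))
    = (\<lambda>nb. (m, nb, stage1_weights k c)) ` slot_assignments n d m (stage1_slots c)"
  using assms slot_assignments_nonempty[of "stage1_slots c" m d n]
  by (simp add: attach_slots_def slot_total_def finite_slot_assignments)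

lemma prob_attach_slots:
  assumes "slot_total (m, c) \<le> d * n"
  shows "measure_pmf.prob (attach_slots n d k (m, c)) A
    = real (card {nb\<in>slot_assignments n d m (stage1_slots c). (m, nb, stage1_weights k c) \<in> A})
      / real (card (slot_assignments n d m (stage1_slots c)))"
  using assms slot_assignments_nonempty[of "stage1_slots c" m d n]
  by (simp add: attach_slots_def slot_total_def finite_slot_assignments measure_pmf_of_set Int_def)

lemma bp_error_nonneg: "0 \<le> bp_error n G"
  by (cases G) (auto simp: bp_error_def intro!: sum_nonneg)

lemma prob_bind_pmf_le:
  assumes r_nonneg: "0 \<le> r"
    and prob_le: "\<And>z. z \<in> set_pmf p \<Longrightarrow> z \<notin> B \<Longrightarrow> measure_pmf.prob (f z) A \<le> r"
  shows "measure_pmf.prob (bind_pmf p f) A \<le> measure_pmf.prob p B + r"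
proof -
  have emeasure_le: "emeasure (f z) A \<le> indicator B z + ennreal r" if "z \<in> set_pmf p" for z
  proof (cases "z \<in> B")
    case True
    then have "emeasure (f z) A \<le> indicator B z"
      using measure_pmf.emeasure_le_1 by simp
    then show ?thesis by (rule order_trans) simp
  next
    case False
    then have "emeasure (f z) A \<le> ennreal r"
      using prob_le that by (simp add: measure_pmf.emeasure_eq_measure ennreal_leI)
    then show ?thesis by (rule order_trans) simp
  qed
  have "emeasure (bind_pmf p f) A = (\<integral>\<^sup>+z. emeasure (f z) A \<partial>p)"
    by (rule emeasure_bind_pmf)
  also have "\<dots> \<le> (\<integral>\<^sup>+z. indicator B z + ennreal r \<partial>p)"
    by (intro nn_integral_mono_AE AE_pmfI emeasure_le)
  also have "\<dots> = ennreal (measure_pmf.prob p B + r)"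
    using r_nonneg by (subst nn_integral_add)
      (auto simp: measure_pmf.emeasure_space_1[simplified] measure_pmf.emeasure_eq_measure ennreal_plus)
  finally show ?thesis
    using r_nonneg by (simp add: measure_pmf.emeasure_eq_measure ennreal_le_iff del: ennreal_plus)
qed

lemma exists_slower_null_sequence:
  fixes x :: "nat \<Rightarrow> real"
  assumes x_tendsto_0: "x \<longlonglongrightarrow> 0" and nonneg: "\<And>n. 0 \<le> x n"
  obtains a where "a \<longlonglongrightarrow> 0" "\<And>n. 0 < a n" "(\<lambda>n. x n / a n) \<longlonglongrightarrow> 0"
proof
  let ?a = "\<lambda>n. sqrt (x n) + inverse (real (Suc n))"
  have sqrt_x: "(\<lambda>n. sqrt (x n)) \<longlonglongrightarrow> 0"
    using tendsto_real_sqrt[OF x_tendsto_0] by simp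
  show "?a \<longlonglongrightarrow> 0"
    using tendsto_add[OF sqrt_x LIMSEQ_inverse_real_of_nat] by simp
  show a_pos: "0 < ?a n" for n
    using nonneg[of n] by (simp add: add_nonneg_pos)
  have "x n / ?a n \<le> sqrt (x n)" for n
  proof -
    have "x n = sqrt (x n) * sqrt (x n)" using nonneg by simp
    also have "\<dots> \<le> sqrt (x n) * ?a n" using nonneg by (intro mult_left_mono) auto
    finally show ?thesis using a_pos[of n] by (simp add: divide_le_eq)
  qed
  moreover have "0 \<le> x n / ?a n" for n
    using nonneg a_pos[of n] by (intro divide_nonneg_pos)
  ultimately show "(\<lambda>n. x n / ?a n) \<longlonglongrightarrow> 0"
    by (intro tendsto_sandwich[OF _ _ tendsto_const sqrt_x]) (auto intro: always_eventually)
qed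

locale percolated_regular_model =
  fixes d k :: nat and eps K :: real and \<rho> :: "('w::finite list \<Rightarrow> real) pmf"
  assumes d_pos: "0 < d" and k_pos: "0 < k" and eps_bounds: "0 < eps" "eps \<le> 1" and K_ge_1: "1 \<le> K"
    and psi_bounds: "\<And>psi J ts. psi \<in> set_pmf \<rho> \<Longrightarrow> J \<subseteq> {..<k} \<Longrightarrow> length ts = card J \<Longrightarrow>
      1 / K \<le> psi_restrict k psi J ts \<and> psi_restrict k psi J ts \<le> K"
begin

abbreviation stage1 :: "nat \<Rightarrow> 'w stage1_outcome pmf" where
  "stage1 \<equiv> reg_stage1 d k eps \<rho>"

abbreviation model :: "nat \<Rightarrow> 'w fgraph pmf" where
  "model \<equiv> reg_model d k eps \<rho>"

lemma stage1_support:
  assumes "0 < n" "(m, c) \<in> set_pmf (stage1 n)"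
  shows "slot_total (m, c) \<le> d * n" "i < m \<Longrightarrow> fst (c i) \<subseteq> {..<k}" "i < m \<Longrightarrow> snd (c i) \<in> set_pmf \<rho>"
proof -
  have support: "(m, c) \<in> set_pmf (free_stage1 d k eps \<rho> n) \<inter> {z. slot_total z \<le> d * n}"
    using assms(2) free_stage1_meets[OF d_pos k_pos assms(1), of eps \<rho>] by (simp add: reg_stage1_eq)
  then show "slot_total (m, c) \<le> d * n" by simp
  assume "i < m"
  have "c \<in> set_pmf (Pi_pmf {..<m} undefined (\<lambda>_. pair_pmf (J_pmf k eps) \<rho>))"
    using support by (auto simp: compound_poisson_pmf_def)
  then have "c i \<in> set_pmf (pair_pmf (J_pmf k eps) \<rho>)"
    using \<open>i < m\<close> by (auto simp: set_Pi_pmf PiE_dflt_def)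
  then show "fst (c i) \<subseteq> {..<k}" "snd (c i) \<in> set_pmf \<rho>"
    by (auto simp: J_pmf_def)
qed

lemma stage1_weights_bounds:
  assumes "0 < n" "(m, c) \<in> set_pmf (stage1 n)" "i < m" "length ts = stage1_slots c i"
  shows "1 / K \<le> stage1_weights k c i ts \<and> stage1_weights k c i ts \<le> K"
  using stage1_support(2,3)[OF assms(1,2)] assms(3,4) psi_bounds by blast

lemma model_positive:
  assumes "0 < n" "G \<in> set_pmf (model n)"
  obtains m nb w where "G = (m, nb, w)" "positive_on nb w {..<m}"
proof -
  obtain m c where stage1_mem: "(m, c) \<in> set_pmf (stage1 n)" and "G \<in> set_pmf (attach_slots n d k (m, c))"
    using assms(2) by (auto simp: reg_model_eq_bind)
  then obtain nb where nb_mem: "nb \<in> slot_assignments n d m (stage1_slots c)"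
      and G_eq: "G = (m, nb, stage1_weights k c)"
    using set_pmf_attach_slots[OF stage1_support(1)[OF assms(1) stage1_mem]] by auto
  have "weights_bdd K nb (stage1_weights k c) {..<m}"
    using K_ge_1 stage1_weights_bounds[OF assms(1) stage1_mem] slot_assignmentsD(2)[OF nb_mem]
    by (simp add: weights_bdd_def)
  with G_eq show thesis by (intro that weights_bdd_positive)
qed

lemma integrable_tv_pair:
  assumes "0 < n"
  shows "integrable (measure_pmf (model n)) (\<lambda>G. tv_pair n G x y)"
proof (rule measure_pmf.integrable_const_bound[where B = 1])
  show "AE G in measure_pmf (model n). norm (tv_pair n G x y) \<le> 1"
    using tv_pair_le_1 by (intro AE_pmfI) (fastforce elim: model_positive[OF assms])
qed simp

definition mean_tv :: "nat \<Rightarrow> real" where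
  "mean_tv n = (1 / (real n)^2) * (\<Sum>i<n. \<Sum>j<n. measure_pmf.expectation (model n) (\<lambda>G. tv_pair n G i j))"

lemma mean_tv_nonneg: "0 \<le> mean_tv n"
  unfolding mean_tv_def
  by (intro mult_nonneg_nonneg sum_nonneg Bochner_Integration.integral_nonneg) auto

lemma prob_tv_total_gt_le:
  assumes n_pos: "0 < n" and \<delta>_pos: "0 < \<delta>"
  shows "measure_pmf.prob (model n) {G. \<delta> * (real n)\<^sup>2 < tv_total n G} \<le> mean_tv n / \<delta>"
proof -
  have "integrable (measure_pmf (model n)) (tv_total n)"
    unfolding tv_total_def using integrable_tv_pair[OF n_pos]
    by (intro Bochner_Integration.integrable_sum)
  then have "measure_pmf.prob (model n) {G \<in> space (model n). \<delta> * (real n)\<^sup>2 \<le> tv_total n G}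
    \<le> measure_pmf.expectation (model n) (tv_total n) / (\<delta> * (real n)\<^sup>2)"
    using assms
    by (intro integral_Markov_inequality_measure[where A = "{}"]) (auto simp: tv_total_nonneg)
  also have "measure_pmf.expectation (model n) (tv_total n)
    = (\<Sum>i<n. \<Sum>j<n. measure_pmf.expectation (model n) (\<lambda>G. tv_pair n G i j))"
    unfolding tv_total_def using integrable_tv_pair[OF n_pos] by simp
  finally have "measure_pmf.prob (model n) {G \<in> space (model n). \<delta> * (real n)\<^sup>2 \<le> tv_total n G}
    \<le> mean_tv n / \<delta>"
    by (simp add: mean_tv_def mult.commute)
  then show ?thesis
    by (rule order_trans[rotated]) (intro measure_pmf.finite_measure_mono, auto)
qed

lemma prob_bp_error_given_stage1_le:
  assumes n_bounds: "0 < n" "4 * real k \<le> eps * real n" and \<delta>_nonneg: "0 \<le> \<delta>" and \<delta>'_pos: "0 < \<delta>'"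
    and stage1_mem: "(m, c) \<in> set_pmf (stage1 n)" "(m, c) \<notin> excess_slots d eps n"
  shows "measure_pmf.prob (attach_slots n d k (m, c))
      {G. tv_total n G \<le> \<delta> * (real n)\<^sup>2 \<and> \<delta>' * real n \<le> bp_error n G}
    \<le> total_const (real CARD('w)) d k K (eps / 2) * sqrt \<delta> / \<delta>'"
proof -
  let ?w = "stage1_weights k c" and ?S = "slot_assignments n d m (stage1_slots c)"
  let ?B = "{nb\<in>?S. tv_total n (m, nb, ?w) \<le> \<delta> * (real n)\<^sup>2 \<and> \<delta>' * real n \<le> bp_error n (m, nb, ?w)}"
  note support = stage1_support[OF n_bounds(1) stage1_mem(1)]
  interpret sparse_slots n m d k "stage1_slots c" ?w K "eps / 2"
  proof
    show "stage1_slots c i \<le> k" if "i < m" for i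
      using card_mono[OF _ support(2)[OF that]] by simp
    show "real (\<Sum>i<m. stage1_slots c i) \<le> (1 - eps / 2) * real d * real n"
      using stage1_mem(2) by (simp add: excess_slots_def slot_total_def)
  qed (use stage1_weights_bounds[OF n_bounds(1) stage1_mem(1)] K_ge_1 d_pos eps_bounds n_bounds in auto)
  have "?S \<noteq> {}"
    using support(1) by (intro slot_assignments_nonempty) (simp add: slot_total_def)
  then have card_pos: "0 < real (card ?S)"
    by (simp add: card_gt_0_iff finite_slot_assignments)
  have "(\<delta>' * real n) * real (card ?B) = (\<Sum>nb\<in>?B. \<delta>' * real n)" by simp
  also have "\<dots> \<le> (\<Sum>nb\<in>?B. of_bool (small_tv \<delta> nb) * bp_error n (m, nb, ?w))"
    by (intro sum_mono) auto
  also have "\<dots> \<le> (\<Sum>nb\<in>?S. of_bool (small_tv \<delta> nb) * bp_error n (m, nb, ?w))"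
    by (intro sum_mono2 finite_slot_assignments) (auto simp: bp_error_nonneg)
  also have "\<dots> \<le> total_const (real CARD('w)) d k K (eps / 2) * sqrt \<delta> * real n * real (card ?S)"
    by (rule sum_bp_error_le[OF \<delta>_nonneg])
  finally have "real (card ?B) / real (card ?S)
    \<le> total_const (real CARD('w)) d k K (eps / 2) * sqrt \<delta> / \<delta>'"
    using n_bounds(1) \<delta>'_pos card_pos by (simp add: field_simps)
  then show ?thesis
    by (simp add: prob_attach_slots[OF support(1)])
qed

lemma prob_bp_error_le:
  assumes n_bounds: "0 < n" "4 * real k \<le> eps * real n" and \<delta>_nonneg: "0 \<le> \<delta>" and \<delta>'_pos: "0 < \<delta>'"
  shows "measure_pmf.prob (model n) {G. tv_total n G \<le> \<delta> * (real n)\<^sup>2 \<and> \<delta>' * real n \<le> bp_error n G}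
    \<le> measure_pmf.prob (stage1 n) (excess_slots d eps n)
      + total_const (real CARD('w)) d k K (eps / 2) * sqrt \<delta> / \<delta>'"
  unfolding reg_model_eq_bind
proof (rule prob_bind_pmf_le)
  show "0 \<le> total_const (real CARD('w)) d k K (eps / 2) * sqrt \<delta> / \<delta>'"
    using K_ge_1 \<delta>_nonneg \<delta>'_pos eps_bounds by (simp add: total_const_nonneg)
  fix z assume "z \<in> set_pmf (stage1 n)" "z \<notin> excess_slots d eps n"
  then show "measure_pmf.prob (attach_slots n d k z)
      {G. tv_total n G \<le> \<delta> * (real n)\<^sup>2 \<and> \<delta>' * real n \<le> bp_error n G}
    \<le> total_const (real CARD('w)) d k K (eps / 2) * sqrt \<delta> / \<delta>'"
    using prob_bp_error_given_stage1_le[OF n_bounds \<delta>_nonneg \<delta>'_pos, of "fst z" "snd z"] by simp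
qed

definition failure_bound :: "nat \<Rightarrow> real \<Rightarrow> real \<Rightarrow> real" where
  "failure_bound n \<delta> \<delta>' = mean_tv n / \<delta> + measure_pmf.prob (stage1 n) (excess_slots d eps n)
     + total_const (real CARD('w)) d k K (eps / 2) * sqrt \<delta> / \<delta>'"

lemma prob_bp_fixpoint_ge:
  assumes n_bounds: "0 < n" "4 * real k \<le> eps * real n" and \<delta>_pos: "0 < \<delta>" and \<delta>'_pos: "0 < \<delta>'"
  shows "1 - failure_bound n \<delta> \<delta>' \<le> measure_pmf.prob (model n) {G. is_bp_fixpoint \<delta>' n G}"
proof -
  let ?X = "{G. \<delta> * (real n)\<^sup>2 < tv_total n G}"
  let ?Y = "{G. tv_total n G \<le> \<delta> * (real n)\<^sup>2 \<and> \<delta>' * real n \<le> bp_error n G}"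
  let ?fix = "{G. is_bp_fixpoint \<delta>' n G}"
  have "1 - measure_pmf.prob (model n) ?fix = measure_pmf.prob (model n) (- ?fix)"
    using measure_pmf.prob_compl[of ?fix "model n"] by (simp add: Compl_eq_Diff_UNIV)
  also have "\<dots> \<le> measure_pmf.prob (model n) (?X \<union> ?Y)"
    by (intro measure_pmf.finite_measure_mono) (auto simp: is_bp_fixpoint_def)
  also have "\<dots> \<le> measure_pmf.prob (model n) ?X + measure_pmf.prob (model n) ?Y"
    by (intro measure_Un_le) auto
  also have "\<dots> \<le> failure_bound n \<delta> \<delta>'"
    using prob_tv_total_gt_le[OF n_bounds(1) \<delta>_pos] prob_bp_error_le[OF n_bounds _ \<delta>'_pos, of \<delta>] \<delta>_pos
    by (simp add: failure_bound_def)
  finally show ?thesis by linarith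
qed

theorem bp_fixpoint_whp:
  assumes mean_tv_tendsto_0: "mean_tv \<longlonglongrightarrow> 0"
  shows "\<exists>\<delta>. \<delta> \<longlonglongrightarrow> 0 \<and> (\<lambda>n. measure_pmf.prob (model n) {G. is_bp_fixpoint (\<delta> n) n G}) \<longlonglongrightarrow> 1"
proof -
  let ?C = "total_const (real CARD('w)) d k K (eps / 2)"
  obtain a where a: "a \<longlonglongrightarrow> 0" "\<And>n. 0 < a n" "(\<lambda>n. mean_tv n / a n) \<longlonglongrightarrow> 0"
    using mean_tv_tendsto_0 mean_tv_nonneg by (rule exists_slower_null_sequence) (rule that)
  have "(\<lambda>n. ?C * sqrt (a n)) \<longlonglongrightarrow> 0"
    using tendsto_mult[OF tendsto_const tendsto_real_sqrt[OF a(1)]] by simp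
  moreover have "0 \<le> ?C * sqrt (a n)" for n
    using a(2)[of n] K_ge_1 eps_bounds by (simp add: total_const_nonneg)
  ultimately obtain \<delta> where \<delta>: "\<delta> \<longlonglongrightarrow> 0" "\<And>n. 0 < \<delta> n" "(\<lambda>n. ?C * sqrt (a n) / \<delta> n) \<longlonglongrightarrow> 0"
    by (rule exists_slower_null_sequence) (rule that)
  have "\<forall>\<^sub>F n in sequentially. 4 * real k / eps \<le> real n"
    using filterlim_real_sequentially unfolding filterlim_at_top by blast
  then have lower: "\<forall>\<^sub>F n in sequentially.
      1 - failure_bound n (a n) (\<delta> n) \<le> measure_pmf.prob (model n) {G. is_bp_fixpoint (\<delta> n) n G}"
    using eventually_gt_at_top[of 0]
    by eventually_elim
      (rule prob_bp_fixpoint_ge, use eps_bounds a(2) \<delta>(2) in \<open>simp_all add: divide_le_eq mult.commute\<close>)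
  have "(\<lambda>n. 1 - failure_bound n (a n) (\<delta> n)) \<longlonglongrightarrow> 1"
    unfolding failure_bound_def
    by (rule tendsto_eq_intros a(3) \<delta>(3) prob_excess_slots_tendsto_0[OF eps_bounds d_pos k_pos] refl)+ simp
  then have "(\<lambda>n. measure_pmf.prob (model n) {G. is_bp_fixpoint (\<delta> n) n G}) \<longlonglongrightarrow> 1"
    by (rule tendsto_sandwich[OF lower _ _ tendsto_const, rotated]) simp
  with \<delta>(1) show ?thesis by blast
qed

end

theorem theorem4:
  fixes d k :: nat and eps :: real
    and \<Psi> :: "('w::finite list \<Rightarrow> real) set" and \<rho> :: "('w list \<Rightarrow> real) pmf"
  assumes "d > 0" and "k \<ge> 3"
    and "finite \<Psi>" and "\<Psi> \<noteq> {}"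
    and "\<forall>psi\<in>\<Psi>. \<forall>\<tau>. length \<tau> = k \<longrightarrow> psi \<tau> > 0"
    and "set_pmf \<rho> \<subseteq> \<Psi>"
    and "eps > 0"
    and "(\<lambda>n. (1 / (real n)^2) * (\<Sum>i<n. \<Sum>j<n.
            measure_pmf.expectation (reg_model d k eps \<rho> n) (\<lambda>G. tv_pair n G i j)))
          \<longlonglongrightarrow> 0"
  shows "\<exists>\<delta> :: nat \<Rightarrow> real. \<delta> \<longlonglongrightarrow> 0 \<and>
           (\<lambda>n. measure_pmf.prob (reg_model d k eps \<rho> n) {G. is_bp_fixpoint (\<delta> n) n G})
             \<longlonglongrightarrow> 1"
proof -
  obtain K where "1 \<le> K" "\<And>psi J ts. psi \<in> \<Psi> \<Longrightarrow> J \<subseteq> {..<k} \<Longrightarrow> length ts = card J \<Longrightarrow>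
      1 / K \<le> psi_restrict k psi J ts \<and> psi_restrict k psi J ts \<le> K"
    by (rule psi_restrict_bounds[OF assms(3,5)]) blast
  then interpret percolated_regular_model d k "min eps 1" K \<rho>
    using assms by unfold_locales auto
  have "mean_tv \<longlonglongrightarrow> 0"
    using assms(8) by (simp add: mean_tv_def[abs_def] reg_model_min[of d k eps])
  then show ?thesis
    unfolding reg_model_min[of d k eps] by (rule bp_fixpoint_whp)
qed

end
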